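(* Let $(L,\Delta,\varphi_L,\alpha,R)$ be a Rota-Baxter Hom-CoAss CoDer pair of weight $\lambda=-1$, where $R\circ\alpha=\alpha\circ R$ and $\varphi_L\circ R=R\circ\varphi_L$. Define $\tilde\Delta:L\to L\otimes L$ by $$\tilde\Delta=(R\otimes 1_L)\circ\Delta-\tau\circ(1_L\otimes R)\circ\Delta-\Delta,$$ i.e. $\tilde\Delta(l)=R(l_1)\otimes l_2-R(l_2)\otimes l_1-l_1\otimes l_2$ for $\Delta(l)=l_1\otimes l_2$ (Sweedler notation). Then $(L,\tilde\Delta,\varphi_L,\alpha)$ is a Hom-pre-Lie CoDer pair.
   Context: All vector spaces and tensor products are over a field $\mathbb{K}$ of characteristic $0$. Let $\tau(x\otimes y)=y\otimes x$ and $\tau^{12}(x\otimes y\otimes z)=y\otimes x\otimes z$. Sweedler notation $\Delta(l)=l_1\otimes l_2$ (summation suppressed) is used. A Hom-CoAss CoDer pair $(L,\Delta,\varphi_L,\alpha)$ is a vector space $L$ with linear maps $\Delta:L\to L\otimes L$, $\alpha:L\to L$, $\varphi_L:L\to L$ such that $(\alpha\otimes\Delta)\circ\Delta=(\Delta\otimes\alpha)\circ\Delta$ (Hom-coassociativity) and $\Delta\circ\varphi_L=(\varphi_L\otimes\alpha)\circ\Delta+(\alpha\otimes\varphi_L)\circ\Delta$. It is a Rota-Baxter Hom-CoAss CoDer pair of weight $\lambda\in\mathbb{K}$ if moreover there is given a linear map $R:L\to L$ with $R\circ\alpha=\alpha\circ R$, $\varphi_L\circ R=R\circ\varphi_L$,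 and for all $l\in L$ $$R(l_1)\otimes R(l_2)=R(l)_1\otimes R(R(l)_2)+R(R(l)_1)\otimes R(l)_2+\lambda\,R(l)_1\otimes R(l)_2,$$ where $\Delta(R(l))=R(l)_1\otimes R(l)_2$; equivalently $(R\otimes R)\circ\Delta=(1\otimes R+R\otimes 1+\lambda\,\mathrm{id})\circ\Delta\circ R$. A Hom-pre-Lie CoDer pair $(L,\Delta_0,\varphi_L,\alpha)$ is a vector space $L$ with linear maps $\Delta_0:L\to L\otimes L$, $\alpha,\varphi_L:L\to L$ such that $(1-\tau^{12})\circ\big((\Delta_0\otimes\alpha)\circ\Delta_0-(\alpha\otimes\Delta_0)\circ\Delta_0\big)=0$ and $\Delta_0\circ\varphi_L=(\varphi_L\otimes\alpha+\alpha\otimes\varphi_L)\circ\Delta_0$. *)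

theory Defs
  imports "Jordan_Normal_Form.Missing_VectorSpace" "HOL-Algebra.AbelCoset"
begin

section \<open>Tensor products of vector spaces\<close>

text \<open>
  Following the AFP vector space library, a vector space over \<open>K\<close> is a record \<open>V\<close> with
  \<open>vectorspace K V\<close>. The multiplicative fields of such a record carry no meaning; they are set
  to \<open>undefined\<close> below.
\<close>

definition free_space :: "('k, 'r) ring_scheme \<Rightarrow> 's set \<Rightarrow> ('k, 's \<Rightarrow> 'k) module" where
  "free_space K S =
    \<lparr> carrier = {f. (\<forall>s \<in> S. f s \<in> carrier K) \<and> (\<forall>s. s \<notin> S \<longrightarrow> f s = \<zero>\<^bsub>K\<^esub>)
                    \<and> finite {s. f s \<noteq> \<zero>\<^bsub>K\<^esub>}},
      mult = undefined,
      one = undefined,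
      zero = (\<lambda>_. \<zero>\<^bsub>K\<^esub>),
      add = (\<lambda>f g s. f s \<oplus>\<^bsub>K\<^esub> g s),
      smult = (\<lambda>c f s. c \<otimes>\<^bsub>K\<^esub> f s) \<rparr>"

definition free_gen :: "('k, 'r) ring_scheme \<Rightarrow> 's \<Rightarrow> 's \<Rightarrow> 'k" where
  "free_gen K s = (\<lambda>t. if t = s then \<one>\<^bsub>K\<^esub> else \<zero>\<^bsub>K\<^esub>)"

text \<open>The union over \<open>C\<close> in the scalar multiplication makes it manifestly independent of a
  representative of the coset \<open>C\<close>; all the cosets in the union coincide.\<close>
definition quotient_space ::
  "('k, 'v, 'm) module_scheme \<Rightarrow> 'v set \<Rightarrow> ('k, 'v set) module" where
  "quotient_space V H =
    \<lparr> carrier = a_rcosets\<^bsub>V\<^esub> H,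
      mult = undefined,
      one = undefined,
      zero = H,
      add = set_add V,
      smult = (\<lambda>c C. \<Union>v \<in> C. H +>\<^bsub>V\<^esub> (c \<odot>\<^bsub>V\<^esub> v)) \<rparr>"

abbreviation tensor_free ::
  "('k, 'r) ring_scheme \<Rightarrow> ('k, 'v, 'm) module_scheme \<Rightarrow> ('k, 'w, 'n) module_scheme
    \<Rightarrow> ('k, 'v \<times> 'w \<Rightarrow> 'k) module" where
  "tensor_free K V W \<equiv> free_space K (carrier V \<times> carrier W)"

definition tensor_relators ::
  "('k, 'r) ring_scheme \<Rightarrow> ('k, 'v, 'm) module_scheme \<Rightarrow> ('k, 'w, 'n) module_scheme
    \<Rightarrow> ('v \<times> 'w \<Rightarrow> 'k) set" where
  "tensor_relators K V W =
    (let F = tensor_free K V W; e = (\<lambda>v w. free_gen K (v, w)) in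
      {e (v \<oplus>\<^bsub>V\<^esub> v') w \<ominus>\<^bsub>F\<^esub> (e v w \<oplus>\<^bsub>F\<^esub> e v' w) | v v' w.
          v \<in> carrier V \<and> v' \<in> carrier V \<and> w \<in> carrier W}
    \<union> {e v (w \<oplus>\<^bsub>W\<^esub> w') \<ominus>\<^bsub>F\<^esub> (e v w \<oplus>\<^bsub>F\<^esub> e v w') | v w w'.
          v \<in> carrier V \<and> w \<in> carrier W \<and> w' \<in> carrier W}
    \<union> {e (c \<odot>\<^bsub>V\<^esub> v) w \<ominus>\<^bsub>F\<^esub> (c \<odot>\<^bsub>F\<^esub> e v w) | c v w.
          c \<in> carrier K \<and> v \<in> carrier V \<and> w \<in> carrier W}
    \<union> {e v (c \<odot>\<^bsub>W\<^esub> w) \<ominus>\<^bsub>F\<^esub> (c \<odot>\<^bsub>F\<^esub> e v w) | c v w.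
          c \<in> carrier K \<and> v \<in> carrier V \<and> w \<in> carrier W})"

definition tensor_null ::
  "('k, 'r) ring_scheme \<Rightarrow> ('k, 'v, 'm) module_scheme \<Rightarrow> ('k, 'w, 'n) module_scheme
    \<Rightarrow> ('v \<times> 'w \<Rightarrow> 'k) set" where
  "tensor_null K V W = module.span K (tensor_free K V W) (tensor_relators K V W)"

definition tensor_space ::
  "('k, 'r) ring_scheme \<Rightarrow> ('k, 'v, 'm) module_scheme \<Rightarrow> ('k, 'w, 'n) module_scheme
    \<Rightarrow> ('k, ('v \<times> 'w \<Rightarrow> 'k) set) module" where
  "tensor_space K V W = quotient_space (tensor_free K V W) (tensor_null K V W)"

definition pure_tensor ::
  "('k, 'r) ring_scheme \<Rightarrow> ('k, 'v, 'm) module_scheme \<Rightarrow> ('k, 'w, 'n) module_scheme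
    \<Rightarrow> 'v \<Rightarrow> 'w \<Rightarrow> ('v \<times> 'w \<Rightarrow> 'k) set" where
  "pure_tensor K V W v w = tensor_null K V W +>\<^bsub>tensor_free K V W\<^esub> free_gen K (v, w)"

text \<open>The linear map \<open>V \<otimes> W \<rightarrow> P\<close> with \<open>v \<otimes> w \<mapsto> b v w\<close> induced by a bilinear map
  \<open>b : V \<times> W \<rightarrow> P\<close>: for bilinear \<open>b\<close> the linear extension of \<open>b\<close> to formal sums is constant on
  each coset \<open>T\<close>, so its image of \<open>T\<close> is a singleton.\<close>
definition tensor_lift ::
  "('k, 'r) ring_scheme \<Rightarrow> ('k, 'p, 'q) module_scheme \<Rightarrow> ('v \<Rightarrow> 'w \<Rightarrow> 'p)
    \<Rightarrow> ('v \<times> 'w \<Rightarrow> 'k) set \<Rightarrow> 'p" where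
  "tensor_lift K P b T =
    the_elem ((\<lambda>f. \<Oplus>\<^bsub>P\<^esub>s \<in> {s. f s \<noteq> \<zero>\<^bsub>K\<^esub>}. f s \<odot>\<^bsub>P\<^esub> b (fst s) (snd s)) ` T)"

text \<open>\<open>f \<otimes> g\<close>; the space arguments are the codomains of \<open>f\<close> and \<open>g\<close>.\<close>
definition tensor_map ::
  "('k, 'r) ring_scheme \<Rightarrow> ('k, 'p, 'm) module_scheme \<Rightarrow> ('k, 'q, 'n) module_scheme
    \<Rightarrow> ('v \<Rightarrow> 'p) \<Rightarrow> ('w \<Rightarrow> 'q) \<Rightarrow> ('v \<times> 'w \<Rightarrow> 'k) set \<Rightarrow> ('p \<times> 'q \<Rightarrow> 'k) set" where
  "tensor_map K P Q f g =
    tensor_lift K (tensor_space K P Q) (\<lambda>v w. pure_tensor K P Q (f v) (g w))"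

definition tensor_flip ::
  "('k, 'r) ring_scheme \<Rightarrow> ('k, 'v, 'm) module_scheme \<Rightarrow> ('k, 'w, 'n) module_scheme
    \<Rightarrow> ('v \<times> 'w \<Rightarrow> 'k) set \<Rightarrow> ('w \<times> 'v \<Rightarrow> 'k) set" where
  "tensor_flip K V W = tensor_lift K (tensor_space K W V) (\<lambda>v w. pure_tensor K W V w v)"

text \<open>The canonical map \<open>U \<otimes> (V \<otimes> W) \<rightarrow> (U \<otimes> V) \<otimes> W\<close>, left implicit in informal notation.\<close>
definition tensor_assoc ::
  "('k, 'r) ring_scheme \<Rightarrow> ('k, 'u, 'l) module_scheme \<Rightarrow> ('k, 'v, 'm) module_scheme
    \<Rightarrow> ('k, 'w, 'n) module_scheme
    \<Rightarrow> ('u \<times> ('v \<times> 'w \<Rightarrow> 'k) set \<Rightarrow> 'k) set \<Rightarrow> (('u \<times> 'v \<Rightarrow> 'k) set \<times> 'w \<Rightarrow> 'k) set" where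
  "tensor_assoc K U V W =
    (let UV = tensor_space K U V; P = tensor_space K UV W in
      tensor_lift K P (\<lambda>u.
        tensor_lift K P (\<lambda>v w. pure_tensor K UV W (pure_tensor K U V u v) w)))"


section \<open>Hom-coassociative and Hom-pre-Lie CoDer pairs\<close>

locale vectorspace_char_0 = vectorspace K V for K V +
  assumes char_0: "n > 0 \<Longrightarrow> add_pow K (n :: nat) \<one>\<^bsub>K\<^esub> \<noteq> \<zero>\<^bsub>K\<^esub>"

locale coproduct_pair = vectorspace_char_0 K L
  for K :: "('k, 'r) ring_scheme" and L :: "('k, 'l, 'm) module_scheme" +
  fixes \<Delta> :: "'l \<Rightarrow> ('l \<times> 'l \<Rightarrow> 'k) set" and \<phi> \<alpha> :: "'l \<Rightarrow> 'l"
  assumes coproduct_linear: "linear_map K L (tensor_space K L L) \<Delta>"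
    and coder_linear: "linear_map K L L \<phi>"
    and twist_linear: "linear_map K L L \<alpha>"
begin

abbreviation LL :: "('k, ('l \<times> 'l \<Rightarrow> 'k) set) module" where
  "LL \<equiv> tensor_space K L L"

abbreviation LLL :: "('k, (('l \<times> 'l \<Rightarrow> 'k) set \<times> 'l \<Rightarrow> 'k) set) module" where
  "LLL \<equiv> tensor_space K LL L"

definition coproduct_twist :: "'l \<Rightarrow> (('l \<times> 'l \<Rightarrow> 'k) set \<times> 'l \<Rightarrow> 'k) set" where
  "coproduct_twist l = tensor_map K LL L \<Delta> \<alpha> (\<Delta> l)"

definition twist_coproduct :: "'l \<Rightarrow> (('l \<times> 'l \<Rightarrow> 'k) set \<times> 'l \<Rightarrow> 'k) set" where
  "twist_coproduct l = tensor_assoc K L L L (tensor_map K L LL \<alpha> \<Delta> (\<Delta> l))"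

text \<open>\<open>\<tau>\<^sup>1\<^sup>2(x \<otimes> y \<otimes> z) = y \<otimes> x \<otimes> z\<close>\<close>
definition flip12 ::
  "(('l \<times> 'l \<Rightarrow> 'k) set \<times> 'l \<Rightarrow> 'k) set \<Rightarrow> (('l \<times> 'l \<Rightarrow> 'k) set \<times> 'l \<Rightarrow> 'k) set" where
  "flip12 = tensor_map K LL L (tensor_flip K L L) (\<lambda>l. l)"

end

locale coder_pair = coproduct_pair +
  assumes coder: "l \<in> carrier L \<Longrightarrow>
    \<Delta> (\<phi> l) = tensor_map K L L \<phi> \<alpha> (\<Delta> l) \<oplus>\<^bsub>LL\<^esub> tensor_map K L L \<alpha> \<phi> (\<Delta> l)"

locale hom_coass_coder_pair = coder_pair +
  assumes hom_coassociative: "l \<in> carrier L \<Longrightarrow> twist_coproduct l = coproduct_twist l"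

locale hom_pre_lie_coder_pair = coder_pair +
  assumes hom_pre_lie: "l \<in> carrier L \<Longrightarrow>
    (coproduct_twist l \<ominus>\<^bsub>LLL\<^esub> twist_coproduct l)
      \<ominus>\<^bsub>LLL\<^esub> flip12 (coproduct_twist l \<ominus>\<^bsub>LLL\<^esub> twist_coproduct l) = \<zero>\<^bsub>LLL\<^esub>"

locale rota_baxter_hom_coass_coder_pair = hom_coass_coder_pair K L \<Delta> \<phi> \<alpha>
  for K :: "('k, 'r) ring_scheme" and L :: "('k, 'l, 'm) module_scheme" and \<Delta> \<phi> \<alpha> +
  fixes R :: "'l \<Rightarrow> 'l" and weight :: 'k
  assumes weight_closed: "weight \<in> carrier K"
    and rota_baxter_linear: "linear_map K L L R"
    and rota_baxter_twist: "l \<in> carrier L \<Longrightarrow> R (\<alpha> l) = \<alpha> (R l)"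
    and rota_baxter_coder: "l \<in> carrier L \<Longrightarrow> \<phi> (R l) = R (\<phi> l)"
    and rota_baxter: "l \<in> carrier L \<Longrightarrow>
      tensor_map K L L R R (\<Delta> l) =
        tensor_map K L L (\<lambda>x. x) R (\<Delta> (R l)) \<oplus>\<^bsub>LL\<^esub> tensor_map K L L R (\<lambda>x. x) (\<Delta> (R l))
          \<oplus>\<^bsub>LL\<^esub> weight \<odot>\<^bsub>LL\<^esub> \<Delta> (R l)"

end

theory Submission
  imports Defs
begin

text \<open>
  Dually, \<open>\<Delta>\<close> is a product, and the theorem is the classical fact that a Rota-Baxter algebra of
  weight \<open>-1\<close> is a left pre-Lie algebra under \<open>x \<circ> y = R x y - y R x - x y\<close>. Its reason is that \<open>\<circ>\<close> has
  the same commutator as the double product \<open>x * y = R x y + x R y - x y\<close>, for which the Rota-Baxter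
  identity reads \<open>R (x * y) = R x R y\<close>. In the associator \<open>(x \<circ> y) \<circ> \<alpha> z - \<alpha> x \<circ> (y \<circ> z)\<close>, antisymmetrised
  in \<open>x\<close> and \<open>y\<close>, the inner product of the first term may therefore be replaced by \<open>x * y\<close>. Afterwards
  \<open>R\<close> is applied to single letters only, associativity makes every term a word in three letters, and
  what does not cancel is symmetric in \<open>x\<close> and \<open>y\<close>.

  For a coproduct the same computation has to be done with operators. The new coproduct is
  \<open>\<Delta>' = pre_lie_map \<circ> \<Delta>\<close>, and the dual of the double product is \<open>double_map \<circ> \<Delta>\<close>. The equality of
  commutators is \<open>pre_lie_map_antisymmetrized\<close>, and the Rota-Baxter identity is \<open>double_map_coproduct\<close>.
  Together with Hom-coassociativity and \<open>R \<circ> \<alpha> = \<alpha> \<circ> R\<close> they turn the two iterates of \<open>\<Delta>'\<close> at \<open>l\<close>, the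
  first up to elements fixed by \<open>\<tau>\<^sup>1\<^sup>2\<close>, into the values \<open>left_iterate d\<close> and \<open>right_iterate d\<close> of two linear
  operators at the one tensor \<open>d = (\<alpha> \<otimes> \<Delta>) (\<Delta> l)\<close>. That the difference of these operators has values fixed
  by \<open>\<tau>\<^sup>1\<^sup>2\<close> is \<open>iterate_difference_symmetric\<close>, which is checked on pure tensors. The compatibility with \<open>\<phi>\<close>
  holds because \<open>pre_lie_map\<close> commutes with \<open>\<phi> \<otimes> \<alpha> + \<alpha> \<otimes> \<phi>\<close>.

  Reducing to pure tensors, and evaluating \<open>f \<otimes> g\<close>, the flip and the reassociation there, is the
  universal property of the tensor product (\<open>tensor_linear_eqI\<close>, \<open>tensor_lift\<close>). It is derived from the
  construction as a quotient of a free vector space.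
\<close>

section \<open>Linear maps\<close>

lemma linear_mapI:
  assumes "vectorspace K V" "vectorspace K W"
    and "\<And>x. x \<in> carrier V \<Longrightarrow> f x \<in> carrier W"
    and "\<And>x y. x \<in> carrier V \<Longrightarrow> y \<in> carrier V \<Longrightarrow> f (x \<oplus>\<^bsub>V\<^esub> y) = f x \<oplus>\<^bsub>W\<^esub> f y"
    and "\<And>c x. c \<in> carrier K \<Longrightarrow> x \<in> carrier V \<Longrightarrow> f (c \<odot>\<^bsub>V\<^esub> x) = c \<odot>\<^bsub>W\<^esub> f x"
  shows "linear_map K V W f"
  using assms
  by (auto simp: linear_map_def mod_hom_def mod_hom_axioms_def module_hom_def vectorspace_def)

lemma linear_map_vectorspace:
  assumes "linear_map K V W f"
  shows "vectorspace K V" "vectorspace K W"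
  using assms by (auto simp: linear_map_def)

lemma linear_map_rules:
  assumes "linear_map K V W f"
  shows "x \<in> carrier V \<Longrightarrow> f x \<in> carrier W"
    and "x \<in> carrier V \<Longrightarrow> y \<in> carrier V \<Longrightarrow> f (x \<oplus>\<^bsub>V\<^esub> y) = f x \<oplus>\<^bsub>W\<^esub> f y"
    and "c \<in> carrier K \<Longrightarrow> x \<in> carrier V \<Longrightarrow> f (c \<odot>\<^bsub>V\<^esub> x) = c \<odot>\<^bsub>W\<^esub> f x"
    and "x \<in> carrier V \<Longrightarrow> y \<in> carrier V \<Longrightarrow> f (x \<ominus>\<^bsub>V\<^esub> y) = f x \<ominus>\<^bsub>W\<^esub> f y"
    and "f \<zero>\<^bsub>V\<^esub> = \<zero>\<^bsub>W\<^esub>"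
proof -
  interpret linear_map K V W f by fact
  show "x \<in> carrier V \<Longrightarrow> f x \<in> carrier W"
    and "x \<in> carrier V \<Longrightarrow> y \<in> carrier V \<Longrightarrow> f (x \<oplus>\<^bsub>V\<^esub> y) = f x \<oplus>\<^bsub>W\<^esub> f y"
    and "c \<in> carrier K \<Longrightarrow> x \<in> carrier V \<Longrightarrow> f (c \<odot>\<^bsub>V\<^esub> x) = c \<odot>\<^bsub>W\<^esub> f x"
    and "x \<in> carrier V \<Longrightarrow> y \<in> carrier V \<Longrightarrow> f (x \<ominus>\<^bsub>V\<^esub> y) = f x \<ominus>\<^bsub>W\<^esub> f y"
    and "f \<zero>\<^bsub>V\<^esub> = \<zero>\<^bsub>W\<^esub>"
    by simp_all
qed

lemma linear_map_id: "vectorspace K V \<Longrightarrow> linear_map K V V (\<lambda>x. x)"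
  by (rule linear_mapI) auto

lemma linear_map_comp:
  assumes "linear_map K U V f" "linear_map K V W g"
  shows "linear_map K U W (\<lambda>x. g (f x))"
  by (rule linear_mapI)
    (auto simp: linear_map_rules[OF assms(1)] linear_map_rules[OF assms(2)]
      intro: linear_map_vectorspace[OF assms(1)] linear_map_vectorspace[OF assms(2)])

lemma linear_map_add:
  assumes f: "linear_map K V W f" and g: "linear_map K V W g"
  shows "linear_map K V W (\<lambda>x. f x \<oplus>\<^bsub>W\<^esub> g x)"
proof -
  interpret W: vectorspace K W using linear_map_vectorspace[OF f] by simp
  show ?thesis
    by (rule linear_mapI)
      (auto simp: linear_map_rules[OF f] linear_map_rules[OF g] W.smult_r_distr W.M.a_ac
        intro: linear_map_vectorspace[OF f])
qed

lemma linear_map_minus: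
  assumes f: "linear_map K V W f" and g: "linear_map K V W g"
  shows "linear_map K V W (\<lambda>x. f x \<ominus>\<^bsub>W\<^esub> g x)"
proof -
  interpret W: vectorspace K W using linear_map_vectorspace[OF f] by simp
  show ?thesis
    by (rule linear_mapI)
      (auto simp: linear_map_rules[OF f] linear_map_rules[OF g] W.smult_r_distr W.smult_r_minus
        a_minus_def W.M.minus_add W.M.a_ac intro: linear_map_vectorspace[OF f])
qed

lemma linear_map_smult:
  assumes f: "linear_map K V W f" and c: "c \<in> carrier K"
  shows "linear_map K V W (\<lambda>x. c \<odot>\<^bsub>W\<^esub> f x)"
proof -
  interpret W: vectorspace K W using f by (rule linear_map_vectorspace)
  show ?thesis
    by (rule linear_mapI)
      (auto simp: linear_map_rules[OF f] W.smult_r_distr c W.R.m_comm simp flip: W.smult_assoc1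
        intro: linear_map_vectorspace[OF f])
qed

lemma linear_map_cong:
  assumes f: "linear_map K V W f" and eq: "\<And>x. x \<in> carrier V \<Longrightarrow> g x = f x"
  shows "linear_map K V W g"
proof -
  interpret V: vectorspace K V using f by (rule linear_map_vectorspace)
  show ?thesis
    by (rule linear_mapI)
      (auto simp: eq linear_map_rules[OF f] intro: linear_map_vectorspace[OF f])
qed

section \<open>Differences in abelian groups\<close>

lemma (in abelian_group) minus_eq_iff:
  assumes "x \<in> carrier G" "y \<in> carrier G" "z \<in> carrier G"
  shows "x \<ominus> y = z \<longleftrightarrow> x = z \<oplus> y"
proof
  assume "x \<ominus> y = z"
  then have "z \<oplus> y = x \<oplus> (\<ominus> y \<oplus> y)" using assms by (auto simp: a_minus_def a_assoc)
  then show "x = z \<oplus> y" using assms by (simp add: l_neg)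
next
  assume "x = z \<oplus> y"
  then show "x \<ominus> y = z" using assms by (simp add: a_minus_def a_assoc r_neg)
qed

text \<open>Used together with \<open>minus_eq_iff\<close> as rewrite rules: every subtraction is pulled outwards and then
  moved to the other side of the equation, so that an equation between signed sums becomes one
  between sums, which is decided by associativity and commutativity.\<close>
lemma (in abelian_group) minus_collect:
  assumes "x \<in> carrier G" "y \<in> carrier G" "z \<in> carrier G"
  shows "x = z \<ominus> y \<longleftrightarrow> x \<oplus> y = z"
    and "(x \<ominus> y) \<oplus> z = (x \<oplus> z) \<ominus> y"
    and "z \<oplus> (x \<ominus> y) = (z \<oplus> x) \<ominus> y"
    and "(x \<ominus> y) \<ominus> z = x \<ominus> (y \<oplus> z)"
    and "z \<ominus> (x \<ominus> y) = (z \<oplus> y) \<ominus> x"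
  using assms minus_eq_iff[of z y x]
  by (auto simp: a_minus_def minus_add a_ac)

text \<open>The cancellation behind the pre-Lie identity. The ten letters stand for the terms that occur in
  the two iterated coproducts of \<open>x \<otimes> y \<otimes> z\<close>; the terms \<open>a\<close>, \<open>c\<close>, \<open>d\<close>, \<open>e\<close> cancel, and the other
  six pair up.\<close>
lemma (in abelian_group) associator_difference:
  assumes "a \<in> carrier G" "b \<in> carrier G" "c \<in> carrier G" "d \<in> carrier G" "e \<in> carrier G"
    "f \<in> carrier G" "g \<in> carrier G" "h \<in> carrier G" "i \<in> carrier G" "j \<in> carrier G"
  shows "(a \<ominus> b \<ominus> (c \<oplus> d \<ominus> e)) \<ominus> (a \<ominus> g \<ominus> d \<ominus> (f \<ominus> h \<ominus> j) \<ominus> (c \<ominus> i \<ominus> e)) =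
    g \<oplus> f \<ominus> (b \<oplus> h) \<ominus> (i \<oplus> j)"
  using assms by (simp add: minus_collect minus_eq_iff a_ac)

lemma (in abelian_group) minus_swap:
  assumes "a \<in> carrier G" "b \<in> carrier G" "c \<in> carrier G" "d \<in> carrier G"
  shows "(a \<ominus> b) \<ominus> (c \<ominus> d) = (a \<ominus> c) \<ominus> (b \<ominus> d)"
  using assms by (simp add: minus_collect minus_eq_iff a_ac)

lemma (in abelian_group) exchange_subtrahends:
  assumes "a \<in> carrier G" "b \<in> carrier G" "c \<in> carrier G" "d \<in> carrier G" "e \<in> carrier G"
    "f \<in> carrier G"
  shows "(a \<ominus> b \<ominus> c) \<oplus> (d \<ominus> e \<ominus> f) = (a \<ominus> e \<ominus> c) \<oplus> (d \<ominus> b \<ominus> f)"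
  using assms by (simp add: minus_collect minus_eq_iff a_ac)

section \<open>Free vector spaces\<close>

lemma free_space_simps:
  "carrier (free_space K S) = {f. (\<forall>s \<in> S. f s \<in> carrier K) \<and> (\<forall>s. s \<notin> S \<longrightarrow> f s = \<zero>\<^bsub>K\<^esub>)
      \<and> finite {s. f s \<noteq> \<zero>\<^bsub>K\<^esub>}}"
  "zero (free_space K S) = (\<lambda>_. \<zero>\<^bsub>K\<^esub>)"
  "f \<oplus>\<^bsub>free_space K S\<^esub> g = (\<lambda>s. f s \<oplus>\<^bsub>K\<^esub> g s)"
  "c \<odot>\<^bsub>free_space K S\<^esub> f = (\<lambda>s. c \<otimes>\<^bsub>K\<^esub> f s)"
  by (simp_all add: free_space_def)

lemma free_space_vectorspace:
  assumes "field K"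
  shows "vectorspace K (free_space K S)"
proof -
  interpret K: field K by fact
  let ?F = "free_space K S"
  have val: "f s \<in> carrier K" if "f \<in> carrier ?F" for f s
    using that by (cases "s \<in> S") (auto simp: free_space_simps)
  have add: "f \<oplus>\<^bsub>?F\<^esub> g \<in> carrier ?F" if "f \<in> carrier ?F" "g \<in> carrier ?F" for f g
  proof -
    have "finite ({s. f s \<noteq> \<zero>\<^bsub>K\<^esub>} \<union> {s. g s \<noteq> \<zero>\<^bsub>K\<^esub>})"
      using that by (simp add: free_space_simps)
    then have "finite {s. f s \<oplus>\<^bsub>K\<^esub> g s \<noteq> \<zero>\<^bsub>K\<^esub>}"
      by (rule rev_finite_subset) auto
    then show ?thesis using that by (auto simp: free_space_simps)
  qed
  have smult: "c \<odot>\<^bsub>?F\<^esub> f \<in> carrier ?F" if "c \<in> carrier K" "f \<in> carrier ?F" for c f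
  proof -
    have "finite {s. f s \<noteq> \<zero>\<^bsub>K\<^esub>}" using that by (simp add: free_space_simps)
    then have "finite {s. c \<otimes>\<^bsub>K\<^esub> f s \<noteq> \<zero>\<^bsub>K\<^esub>}"
      by (rule rev_finite_subset) (use that(1) in auto)
    then show ?thesis using that by (auto simp: free_space_simps)
  qed
  have zero: "\<zero>\<^bsub>?F\<^esub> \<in> carrier ?F" by (simp add: free_space_simps)
  have neg: "\<exists>g\<in>carrier ?F. f \<oplus>\<^bsub>?F\<^esub> g = \<zero>\<^bsub>?F\<^esub>" if "f \<in> carrier ?F" for f
  proof
    show "(\<ominus>\<^bsub>K\<^esub> \<one>\<^bsub>K\<^esub>) \<odot>\<^bsub>?F\<^esub> f \<in> carrier ?F" using smult that by simp
    show "f \<oplus>\<^bsub>?F\<^esub> ((\<ominus>\<^bsub>K\<^esub> \<one>\<^bsub>K\<^esub>) \<odot>\<^bsub>?F\<^esub> f) = \<zero>\<^bsub>?F\<^esub>"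
      using val[OF that] by (auto simp: free_space_simps K.l_minus K.r_neg)
  qed
  have "module K ?F"
    by (rule module_criteria)
      (use K.is_cring add smult zero neg in \<open>auto simp: val free_space_simps(2-) K.a_ac K.m_assoc K.l_distr K.r_distr\<close>)
  then show ?thesis by (simp add: vectorspace_def assms)
qed

lemma free_gen_closed:
  assumes "field K" "s \<in> S"
  shows "free_gen K s \<in> carrier (free_space K S)"
proof -
  interpret field K by fact
  have "{t. free_gen K s t \<noteq> \<zero>\<^bsub>K\<^esub>} = {s}" by (auto simp: free_gen_def)
  then show ?thesis using assms(2) by (auto simp: free_space_simps free_gen_def)
qed

text \<open>By induction on the support: clearing the coefficient at one point of a formal sum removes a
  multiple of a generator.\<close>
lemma free_space_generated:
  assumes K: "field K" and N: "submodule K N (free_space K S)"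
    and gen: "\<And>s. s \<in> S \<Longrightarrow> free_gen K s \<in> N" and f: "f \<in> carrier (free_space K S)"
  shows "f \<in> N"
proof -
  interpret K: field K by fact
  interpret N: submodule K N "free_space K S" by fact
  have "finite {s. f s \<noteq> \<zero>\<^bsub>K\<^esub>}" using f by (simp add: free_space_simps)
  then obtain A where "finite A" "{s. f s \<noteq> \<zero>\<^bsub>K\<^esub>} \<subseteq> A" by blast
  then show ?thesis using f
  proof (induction A arbitrary: f rule: finite_induct)
    case empty
    then have "f = \<zero>\<^bsub>free_space K S\<^esub>" by (auto simp: free_space_simps)
    then show ?case using N.zero_closed by simp
  next
    case (insert a A)
    define g where "g = f(a := \<zero>\<^bsub>K\<^esub>)"
    have supp: "{s. g s \<noteq> \<zero>\<^bsub>K\<^esub>} \<subseteq> A" using insert.prems by (auto simp: g_def)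
    have g: "g \<in> carrier (free_space K S)"
      using insert.prems finite_subset[OF supp insert.hyps(1)] by (auto simp: free_space_simps g_def)
    have gN: "g \<in> N" using insert.IH supp g by blast
    show ?case
    proof (cases "a \<in> S")
      case True
      have fK: "f s \<in> carrier K" for s
        using insert.prems by (cases "s \<in> S") (auto simp: free_space_simps)
      have "f = f a \<odot>\<^bsub>free_space K S\<^esub> free_gen K a \<oplus>\<^bsub>free_space K S\<^esub> g"
        using fK by (auto simp: free_space_simps g_def free_gen_def)
      moreover have "f a \<odot>\<^bsub>free_space K S\<^esub> free_gen K a \<oplus>\<^bsub>free_space K S\<^esub> g \<in> N"
        using gN gen[OF True] fK by (intro N.m_closed N.smult_closed) auto
      ultimately show ?thesis by simp
    next
      case False
      then have "g = f" using insert.prems by (auto simp: free_space_simps g_def)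
      then show ?thesis using gN by simp
    qed
  qed
qed

text \<open>The linear extension to formal sums that occurs inside \<open>tensor_lift\<close>.\<close>
definition free_lift ::
  "('k, 'r) ring_scheme \<Rightarrow> ('k, 'p, 'q) module_scheme \<Rightarrow> ('s \<Rightarrow> 'p) \<Rightarrow> ('s \<Rightarrow> 'k) \<Rightarrow> 'p" where
  "free_lift K P b f = (\<Oplus>\<^bsub>P\<^esub>s \<in> {s. f s \<noteq> \<zero>\<^bsub>K\<^esub>}. f s \<odot>\<^bsub>P\<^esub> b s)"

text \<open>Summing over a larger finite set than the support makes the linear extension of two formal sums
  comparable: both can be summed over the union of the supports.\<close>
lemma free_lift_eq_finsum:
  assumes P: "vectorspace K P" and b: "\<And>s. s \<in> S \<Longrightarrow> b s \<in> carrier P"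
    and f: "f \<in> carrier (free_space K S)"
    and A: "finite A" "A \<subseteq> S" "{s. f s \<noteq> \<zero>\<^bsub>K\<^esub>} \<subseteq> A"
  shows "free_lift K P b f = (\<Oplus>\<^bsub>P\<^esub>s \<in> A. f s \<odot>\<^bsub>P\<^esub> b s)"
proof -
  interpret P: vectorspace K P by fact
  have "f s \<odot>\<^bsub>P\<^esub> b s \<in> carrier P" if "s \<in> A" for s
    using that A f b by (auto simp: free_space_simps)
  moreover have "f s \<odot>\<^bsub>P\<^esub> b s = \<zero>\<^bsub>P\<^esub>" if "s \<in> A - {s. f s \<noteq> \<zero>\<^bsub>K\<^esub>}" for s
    using that A b by auto
  ultimately show ?thesis
    unfolding free_lift_def by (intro P.M.add.finprod_mono_neutral_cong_left A) auto
qed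

lemma free_lift_linear:
  fixes P (structure)
  assumes P: "vectorspace K P" and b: "\<And>s. s \<in> S \<Longrightarrow> b s \<in> carrier P"
  shows "linear_map K (free_space K S) P (free_lift K P b)"
proof -
  interpret P: vectorspace K P by fact
  interpret F: vectorspace K "free_space K S" using P.field_axioms by (rule free_space_vectorspace)
  let ?F = "free_space K S"
  let ?supp = "\<lambda>f. {s. f s \<noteq> \<zero>\<^bsub>K\<^esub>}"
  have supp: "finite (?supp f)" "?supp f \<subseteq> S" if "f \<in> carrier ?F" for f
    using that by (auto simp: free_space_simps)
  have val: "f s \<in> carrier K" if "f \<in> carrier ?F" "s \<in> S" for f s
    using that by (auto simp: free_space_simps)
  have eq: "free_lift K P b f = (\<Oplus>s\<in>A. f s \<odot> b s)"
    if "f \<in> carrier ?F" "finite A" "A \<subseteq> S" "?supp f \<subseteq> A" for f A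
    by (rule free_lift_eq_finsum[OF P b that])
  show ?thesis
  proof (rule linear_mapI)
    fix f assume f: "f \<in> carrier ?F"
    show "free_lift K P b f \<in> carrier P"
      unfolding free_lift_def using supp[OF f] val[OF f] b by (intro P.M.finsum_closed) blast
  next
    fix f g assume fg: "f \<in> carrier ?F" "g \<in> carrier ?F"
    let ?A = "?supp f \<union> ?supp g"
    have A: "finite ?A" "?A \<subseteq> S" using fg supp by auto
    have fgc: "f \<oplus>\<^bsub>?F\<^esub> g \<in> carrier ?F" using fg by simp
    have "?supp (f \<oplus>\<^bsub>?F\<^esub> g) \<subseteq> ?A" by (auto simp: free_space_simps)
    then have "free_lift K P b (f \<oplus>\<^bsub>?F\<^esub> g) = (\<Oplus>s\<in>?A. (f \<oplus>\<^bsub>?F\<^esub> g) s \<odot> b s)"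
      by (rule eq[OF fgc A])
    also have "\<dots> = (\<Oplus>s\<in>?A. f s \<odot> b s \<oplus> g s \<odot> b s)"
      using A b val[OF fg(1)] val[OF fg(2)]
      by (intro P.M.finsum_cong') (auto simp: free_space_simps P.smult_l_distr subset_iff)
    also have "\<dots> = (\<Oplus>s\<in>?A. f s \<odot> b s) \<oplus> (\<Oplus>s\<in>?A. g s \<odot> b s)"
      using A b val[OF fg(1)] val[OF fg(2)] by (intro P.M.finsum_addf) blast+
    also have "\<dots> = free_lift K P b f \<oplus> free_lift K P b g"
      using eq[OF fg(1) A] eq[OF fg(2) A] by simp
    finally show "free_lift K P b (f \<oplus>\<^bsub>?F\<^esub> g) = free_lift K P b f \<oplus> free_lift K P b g" .
  next
    fix c f assume c: "c \<in> carrier K" and f: "f \<in> carrier ?F"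
    have cf: "c \<odot>\<^bsub>?F\<^esub> f \<in> carrier ?F" using c f by simp
    have "?supp (c \<odot>\<^bsub>?F\<^esub> f) \<subseteq> ?supp f" using c by (auto simp: free_space_simps)
    then have "free_lift K P b (c \<odot>\<^bsub>?F\<^esub> f) = (\<Oplus>s\<in>?supp f. (c \<odot>\<^bsub>?F\<^esub> f) s \<odot> b s)"
      by (rule eq[OF cf supp[OF f]])
    also have "\<dots> = (\<Oplus>s\<in>?supp f. c \<odot> (f s \<odot> b s))"
      using supp[OF f] b val[OF f] c
      by (intro P.M.finsum_cong') (auto simp: free_space_simps P.smult_assoc1 subset_iff)
    also have "\<dots> = c \<odot> free_lift K P b f"
      unfolding free_lift_def using supp[OF f] b val[OF f] c
      by (intro P.finsum_smult[symmetric]) blast+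
    finally show "free_lift K P b (c \<odot>\<^bsub>?F\<^esub> f) = c \<odot> free_lift K P b f" .
  qed (fact P F.vectorspace_axioms)+
qed

lemma free_lift_gen:
  assumes "vectorspace K P" and "b s \<in> carrier P"
  shows "free_lift K P b (free_gen K s) = b s"
proof -
  interpret P: vectorspace K P by fact
  have "free_lift K P b (free_gen K s) = (\<Oplus>\<^bsub>P\<^esub>t \<in> {s}. free_gen K s t \<odot>\<^bsub>P\<^esub> b t)"
    using assms
    by (intro free_lift_eq_finsum[where S = "{s}"] free_gen_closed P.field_axioms) (auto simp: free_gen_def)
  also have "\<dots> = b s" using assms(2) by (simp add: free_gen_def)
  finally show ?thesis .
qed

section \<open>Quotients\<close>

lemma submodule_abelian_subgroup:
  assumes "vectorspace K V" "submodule K H V"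
  shows "abelian_subgroup H V"
proof -
  interpret V: vectorspace K V by fact
  interpret H: submodule K H V by fact
  have "\<ominus>\<^bsub>V\<^esub> v \<in> H" if "v \<in> H" for v
    using that H.smult_closed[of "\<ominus>\<^bsub>K\<^esub> \<one>\<^bsub>K\<^esub>" v] subsetD[OF H.subset, of v]
    by (simp add: V.smult_minus_1)
  moreover have "H \<noteq> {}" using H.zero_closed by blast
  ultimately have "subgroup H (add_monoid V)"
    using H.subset by (intro V.M.add.subgroupI) auto
  then show ?thesis by (intro abelian_subgroupI3 additive_subgroupI V.M.abelian_group_axioms)
qed

lemma quotient_space_vectorspace:
  assumes V: "vectorspace K V" and H: "submodule K H V"
  shows "vectorspace K (quotient_space V H)"
    and "linear_map K V (quotient_space V H) (\<lambda>v. H +>\<^bsub>V\<^esub> v)"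
    and "carrier (quotient_space V H) = (\<lambda>v. H +>\<^bsub>V\<^esub> v) ` carrier V"
proof -
  interpret V: vectorspace K V by fact
  interpret H: submodule K H V by fact
  interpret G: abelian_subgroup H V using assms by (rule submodule_abelian_subgroup)
  let ?Q = "quotient_space V H"
  show carrier: "carrier ?Q = (\<lambda>v. H +>\<^bsub>V\<^esub> v) ` carrier V"
    by (auto simp: quotient_space_def A_RCOSETS_def')
  have add: "(H +>\<^bsub>V\<^esub> v) \<oplus>\<^bsub>?Q\<^esub> (H +>\<^bsub>V\<^esub> w) = H +>\<^bsub>V\<^esub> (v \<oplus>\<^bsub>V\<^esub> w)"
    if "v \<in> carrier V" "w \<in> carrier V" for v w
    using that by (simp add: quotient_space_def G.a_rcos_sum)
  have zero: "\<zero>\<^bsub>?Q\<^esub> = H +>\<^bsub>V\<^esub> \<zero>\<^bsub>V\<^esub>"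
    by (simp add: quotient_space_def H.subset)
  have smult: "c \<odot>\<^bsub>?Q\<^esub> (H +>\<^bsub>V\<^esub> v) = H +>\<^bsub>V\<^esub> (c \<odot>\<^bsub>V\<^esub> v)"
    if c: "c \<in> carrier K" and v: "v \<in> carrier V" for c v
  proof -
    have "H +>\<^bsub>V\<^esub> (c \<odot>\<^bsub>V\<^esub> w) = H +>\<^bsub>V\<^esub> (c \<odot>\<^bsub>V\<^esub> v)" if w: "w \<in> H +>\<^bsub>V\<^esub> v" for w
    proof -
      obtain h where h: "h \<in> H" "w = h \<oplus>\<^bsub>V\<^esub> v"
        using w by (auto simp: a_r_coset_def')
      then have "c \<odot>\<^bsub>V\<^esub> w = c \<odot>\<^bsub>V\<^esub> h \<oplus>\<^bsub>V\<^esub> c \<odot>\<^bsub>V\<^esub> v"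
        using c v H.subset by (auto simp: V.smult_r_distr)
      then have "c \<odot>\<^bsub>V\<^esub> w \<in> H +>\<^bsub>V\<^esub> (c \<odot>\<^bsub>V\<^esub> v)"
        using c h by (auto simp: a_r_coset_def')
      then show ?thesis
        using c v by (metis V.M.a_repr_independence G.a_subgroup V.smult_closed)
    qed
    then have "(\<Union>w \<in> H +>\<^bsub>V\<^esub> v. H +>\<^bsub>V\<^esub> (c \<odot>\<^bsub>V\<^esub> w)) = (\<Union>w \<in> H +>\<^bsub>V\<^esub> v. H +>\<^bsub>V\<^esub> (c \<odot>\<^bsub>V\<^esub> v))"
      by (rule SUP_cong[OF refl])
    also have "\<dots> = H +>\<^bsub>V\<^esub> (c \<odot>\<^bsub>V\<^esub> v)" using G.a_rcos_self[OF v] by blast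
    finally show ?thesis by (simp add: quotient_space_def)
  qed
  have "module K ?Q"
  proof (rule module_criteria)
    show "\<forall>x\<in>carrier ?Q. \<exists>y\<in>carrier ?Q. x \<oplus>\<^bsub>?Q\<^esub> y = \<zero>\<^bsub>?Q\<^esub>"
    proof
      fix x assume "x \<in> carrier ?Q"
      then obtain v where "v \<in> carrier V" "x = H +>\<^bsub>V\<^esub> v" by (auto simp: carrier)
      then show "\<exists>y\<in>carrier ?Q. x \<oplus>\<^bsub>?Q\<^esub> y = \<zero>\<^bsub>?Q\<^esub>"
        by (intro bexI[where x = "H +>\<^bsub>V\<^esub> (\<ominus>\<^bsub>V\<^esub> v)"])
          (auto simp: carrier add zero V.M.r_neg simp del: V.M.a_coset_add_zero)
    qed
  qed (auto simp: carrier add smult zero V.smult_assoc1 V.smult_l_distr V.smult_r_distr V.M.a_ac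
         simp del: V.M.a_coset_add_zero intro!: imageI V.R.is_cring)
  then show Q: "vectorspace K ?Q" by (simp add: vectorspace_def V.field_axioms)
  show "linear_map K V ?Q (\<lambda>v. H +>\<^bsub>V\<^esub> v)"
    by (rule linear_mapI) (auto simp: add smult carrier intro: V Q)
qed

text \<open>This is why \<open>the_elem\<close> in \<open>tensor_lift\<close> picks the intended value: a linear map that kills the
  subspace is constant on its cosets.\<close>
lemma image_coset_eq:
  assumes f: "linear_map K V P f" and H: "submodule K H V"
    and null: "\<And>h. h \<in> H \<Longrightarrow> f h = \<zero>\<^bsub>P\<^esub>" and v: "v \<in> carrier V"
  shows "f ` (H +>\<^bsub>V\<^esub> v) = {f v}"
proof -
  interpret f: linear_map K V P f by fact
  interpret H: submodule K H V by fact
  have "f (h \<oplus>\<^bsub>V\<^esub> v) = f v" if "h \<in> H" for h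
    using that v H.subset null by auto
  then have "(\<lambda>h. f (h \<oplus>\<^bsub>V\<^esub> v)) ` H = (\<lambda>_. f v) ` H"
    by (rule image_cong[OF refl])
  moreover have "f ` (H +>\<^bsub>V\<^esub> v) = (\<lambda>h. f (h \<oplus>\<^bsub>V\<^esub> v)) ` H"
    by (auto simp: a_r_coset_def')
  moreover have "H \<noteq> {}" using H.zero_closed by blast
  ultimately show ?thesis by (simp add: image_constant_conv)
qed

section \<open>The universal property of tensor products\<close>

text \<open>Linearity in each variable is stated with \<open>linear_map\<close>, so that all rules for linear maps apply to
  bilinear ones.\<close>
definition bilinear_map ::
  "('k, 'r) ring_scheme \<Rightarrow> ('k, 'v, 'm) module_scheme \<Rightarrow> ('k, 'w, 'n) module_scheme
    \<Rightarrow> ('k, 'p, 'q) module_scheme \<Rightarrow> ('v \<Rightarrow> 'w \<Rightarrow> 'p) \<Rightarrow> bool" where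
  "bilinear_map K V W P b \<longleftrightarrow>
    (\<forall>v \<in> carrier V. linear_map K W P (b v)) \<and> (\<forall>w \<in> carrier W. linear_map K V P (\<lambda>v. b v w))"

lemma bilinear_mapD:
  assumes "bilinear_map K V W P b"
  shows "v \<in> carrier V \<Longrightarrow> linear_map K W P (b v)"
    and "w \<in> carrier W \<Longrightarrow> linear_map K V P (\<lambda>v. b v w)"
  using assms by (auto simp: bilinear_map_def)

lemma bilinear_map_comp:
  assumes "bilinear_map K P Q T b" and f: "linear_map K V P f" and g: "linear_map K W Q g"
  shows "bilinear_map K V W T (\<lambda>v w. b (f v) (g w))"
  unfolding bilinear_map_def
  by (auto intro!: linear_map_comp[OF f] linear_map_comp[OF g] bilinear_mapD[OF assms(1)]
      linear_map_rules(1)[OF f] linear_map_rules(1)[OF g])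

lemma bilinear_map_swap: "bilinear_map K V W P b \<Longrightarrow> bilinear_map K W V P (\<lambda>w v. b v w)"
  by (auto simp: bilinear_map_def)

lemma tensor_null_submodule:
  assumes V: "vectorspace K V" and W: "vectorspace K W"
  shows "submodule K (tensor_null K V W) (tensor_free K V W)"
    and "tensor_relators K V W \<subseteq> tensor_null K V W"
    and "tensor_relators K V W \<subseteq> carrier (tensor_free K V W)"
proof -
  interpret V: vectorspace K V by fact
  interpret W: vectorspace K W by fact
  interpret F: vectorspace K "tensor_free K V W"
    using V.field_axioms by (rule free_space_vectorspace)
  have gen: "free_gen K (v, w) \<in> carrier (tensor_free K V W)"
    if "v \<in> carrier V" "w \<in> carrier W" for v w
    using that by (intro free_gen_closed V.field_axioms) auto
  show rel: "tensor_relators K V W \<subseteq> carrier (tensor_free K V W)"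
    unfolding tensor_relators_def Let_def
    by (auto simp: gen)
  show "submodule K (tensor_null K V W) (tensor_free K V W)"
    unfolding tensor_null_def using rel by (rule F.span_is_submodule)
  show "tensor_relators K V W \<subseteq> tensor_null K V W"
    unfolding tensor_null_def using rel by (rule F.in_own_span)
qed

lemma tensor_space_vectorspace:
  assumes V: "vectorspace K V" and W: "vectorspace K W"
  shows "vectorspace K (tensor_space K V W)"
    and tensor_coset_linear: "linear_map K (tensor_free K V W) (tensor_space K V W)
      (\<lambda>f. tensor_null K V W +>\<^bsub>tensor_free K V W\<^esub> f)"
    and tensor_space_carrier: "carrier (tensor_space K V W) =
      (\<lambda>f. tensor_null K V W +>\<^bsub>tensor_free K V W\<^esub> f) ` carrier (tensor_free K V W)"
proof -
  interpret V: vectorspace K V by fact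
  have F: "vectorspace K (tensor_free K V W)" using V.field_axioms by (rule free_space_vectorspace)
  note Q = quotient_space_vectorspace[OF F tensor_null_submodule(1)[OF assms]]
  show "vectorspace K (tensor_space K V W)"
    and "linear_map K (tensor_free K V W) (tensor_space K V W)
      (\<lambda>f. tensor_null K V W +>\<^bsub>tensor_free K V W\<^esub> f)"
    and "carrier (tensor_space K V W) =
      (\<lambda>f. tensor_null K V W +>\<^bsub>tensor_free K V W\<^esub> f) ` carrier (tensor_free K V W)"
    unfolding tensor_space_def by (fact Q)+
qed

text \<open>Each family of relators is one law of bilinearity: the two sides of the law differ by a relator, and
  the quotient map sends relators to zero.\<close>
lemma pure_tensor_bilinear:
  assumes V: "vectorspace K V" and W: "vectorspace K W"
  shows "bilinear_map K V W (tensor_space K V W) (pure_tensor K V W)"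
proof -
  interpret V: vectorspace K V by fact
  interpret W: vectorspace K W by fact
  let ?F = "tensor_free K V W" and ?N = "tensor_null K V W" and ?T = "tensor_space K V W"
  interpret F: vectorspace K ?F
    using V.field_axioms by (rule free_space_vectorspace)
  interpret T: vectorspace K ?T using assms by (rule tensor_space_vectorspace)
  interpret N: abelian_subgroup ?N ?F
    using F.vectorspace_axioms tensor_null_submodule(1)[OF assms] by (rule submodule_abelian_subgroup)
  let ?e = "\<lambda>v w. free_gen K (v, w)" and ?q = "\<lambda>f. ?N +>\<^bsub>?F\<^esub> f"
  note q = linear_map_rules[OF tensor_coset_linear[OF assms]]
  have gen: "?e v w \<in> carrier ?F" if "v \<in> carrier V" "w \<in> carrier W" for v w
    using that by (intro free_gen_closed V.field_axioms) auto
  have rel: "?q f = ?q g" if fg: "f \<ominus>\<^bsub>?F\<^esub> g \<in> tensor_relators K V W" "f \<in> carrier ?F" "g \<in> carrier ?F" for f g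
  proof -
    have "f \<ominus>\<^bsub>?F\<^esub> g \<in> ?N" using fg tensor_null_submodule(2)[OF assms] by auto
    then have "?q (f \<ominus>\<^bsub>?F\<^esub> g) = \<zero>\<^bsub>?T\<^esub>"
      using N.a_subgroup N.a_subset by (subst F.M.a_coset_join2) (auto simp: tensor_space_def quotient_space_def)
    then have "?q f \<ominus>\<^bsub>?T\<^esub> ?q g = \<zero>\<^bsub>?T\<^esub>" using fg q(4) by simp
    then show ?thesis using fg q(1) by (simp add: T.M.minus_other_side)
  qed
  have closed: "pure_tensor K V W v w \<in> carrier ?T" if "v \<in> carrier V" "w \<in> carrier W" for v w
    unfolding pure_tensor_def using that by (intro q gen)
  show ?thesis
    unfolding bilinear_map_def
  proof (intro conjI ballI)
    fix v assume v: "v \<in> carrier V"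
    show "linear_map K W ?T (pure_tensor K V W v)"
    proof (rule linear_mapI)
      fix w w' assume w: "w \<in> carrier W" "w' \<in> carrier W"
      have "?e v (w \<oplus>\<^bsub>W\<^esub> w') \<ominus>\<^bsub>?F\<^esub> (?e v w \<oplus>\<^bsub>?F\<^esub> ?e v w') \<in> tensor_relators K V W"
        unfolding tensor_relators_def Let_def using v w by blast
      then have "?q (?e v (w \<oplus>\<^bsub>W\<^esub> w')) = ?q (?e v w \<oplus>\<^bsub>?F\<^esub> ?e v w')"
        using v w by (intro rel) (auto intro: gen)
      then show "pure_tensor K V W v (w \<oplus>\<^bsub>W\<^esub> w') = pure_tensor K V W v w \<oplus>\<^bsub>?T\<^esub> pure_tensor K V W v w'"
        using v w by (simp add: pure_tensor_def q gen)
    next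
      fix c w assume c: "c \<in> carrier K" and w: "w \<in> carrier W"
      have "?e v (c \<odot>\<^bsub>W\<^esub> w) \<ominus>\<^bsub>?F\<^esub> c \<odot>\<^bsub>?F\<^esub> ?e v w \<in> tensor_relators K V W"
        unfolding tensor_relators_def Let_def using c v w by blast
      then have "?q (?e v (c \<odot>\<^bsub>W\<^esub> w)) = ?q (c \<odot>\<^bsub>?F\<^esub> ?e v w)"
        using c v w by (intro rel) (auto intro: gen)
      then show "pure_tensor K V W v (c \<odot>\<^bsub>W\<^esub> w) = c \<odot>\<^bsub>?T\<^esub> pure_tensor K V W v w"
        using c v w by (simp add: pure_tensor_def q gen)
    qed (use v closed W T.vectorspace_axioms in auto)
  next
    fix w assume w: "w \<in> carrier W"
    show "linear_map K V ?T (\<lambda>v. pure_tensor K V W v w)"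
    proof (rule linear_mapI)
      fix v v' assume v: "v \<in> carrier V" "v' \<in> carrier V"
      have "?e (v \<oplus>\<^bsub>V\<^esub> v') w \<ominus>\<^bsub>?F\<^esub> (?e v w \<oplus>\<^bsub>?F\<^esub> ?e v' w) \<in> tensor_relators K V W"
        unfolding tensor_relators_def Let_def using v w by blast
      then have "?q (?e (v \<oplus>\<^bsub>V\<^esub> v') w) = ?q (?e v w \<oplus>\<^bsub>?F\<^esub> ?e v' w)"
        using v w by (intro rel) (auto intro: gen)
      then show "pure_tensor K V W (v \<oplus>\<^bsub>V\<^esub> v') w = pure_tensor K V W v w \<oplus>\<^bsub>?T\<^esub> pure_tensor K V W v' w"
        using v w by (simp add: pure_tensor_def q gen)
    next
      fix c v assume c: "c \<in> carrier K" and v: "v \<in> carrier V"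
      have "?e (c \<odot>\<^bsub>V\<^esub> v) w \<ominus>\<^bsub>?F\<^esub> c \<odot>\<^bsub>?F\<^esub> ?e v w \<in> tensor_relators K V W"
        unfolding tensor_relators_def Let_def using c v w by blast
      then have "?q (?e (c \<odot>\<^bsub>V\<^esub> v) w) = ?q (c \<odot>\<^bsub>?F\<^esub> ?e v w)"
        using c v w by (intro rel) (auto intro: gen)
      then show "pure_tensor K V W (c \<odot>\<^bsub>V\<^esub> v) w = c \<odot>\<^bsub>?T\<^esub> pure_tensor K V W v w"
        using c v w by (simp add: pure_tensor_def q gen)
    qed (use w closed V T.vectorspace_axioms in auto)
  qed
qed

lemma pure_tensor_closed:
  assumes "vectorspace K V" "vectorspace K W" "v \<in> carrier V" "w \<in> carrier W"
  shows "pure_tensor K V W v w \<in> carrier (tensor_space K V W)"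
  by (rule linear_map_rules(1)[OF bilinear_mapD(1)[OF pure_tensor_bilinear[OF assms(1,2)] assms(3)] assms(4)])

text \<open>The kernel of the difference of the two maps is a subspace, and it contains all generators.\<close>
lemma linear_eqI_free:
  assumes f: "linear_map K (free_space K S) P f" and g: "linear_map K (free_space K S) P g"
    and eq: "\<And>s. s \<in> S \<Longrightarrow> f (free_gen K s) = g (free_gen K s)"
    and x: "x \<in> carrier (free_space K S)"
  shows "f x = g x"
proof -
  let ?h = "\<lambda>x. f x \<ominus>\<^bsub>P\<^esub> g x"
  interpret P: vectorspace K P using f by (rule linear_map_vectorspace)
  interpret h: linear_map K "free_space K S" P ?h using f g by (rule linear_map_minus)
  note closed = linear_map_rules(1)[OF f] linear_map_rules(1)[OF g]
  have "x \<in> h.ker"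
  proof (rule free_space_generated[OF P.field_axioms h.ker_is_submodule _ x])
    fix s assume "s \<in> S"
    then show "free_gen K s \<in> h.ker"
      by (simp add: h.ker_def eq closed P.M.minus_other_side free_gen_closed[OF P.field_axioms])
  qed
  then show ?thesis using x by (simp add: h.ker_def closed P.M.minus_other_side)
qed

text \<open>The uniqueness half of the universal property. All identities between operators on tensor products
  below are reduced by it to identities between pure tensors.\<close>
lemma tensor_linear_eqI:
  assumes V: "vectorspace K V" and W: "vectorspace K W"
    and f: "linear_map K (tensor_space K V W) P f" and g: "linear_map K (tensor_space K V W) P g"
    and eq: "\<And>v w. v \<in> carrier V \<Longrightarrow> w \<in> carrier W \<Longrightarrow>
      f (pure_tensor K V W v w) = g (pure_tensor K V W v w)"
    and t: "t \<in> carrier (tensor_space K V W)"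
  shows "f t = g t"
proof -
  let ?q = "\<lambda>x. tensor_null K V W +>\<^bsub>tensor_free K V W\<^esub> x"
  obtain x where x: "x \<in> carrier (tensor_free K V W)" "t = ?q x"
    using t by (auto simp: tensor_space_carrier[OF V W])
  have "f (?q x) = g (?q x)"
    by (rule linear_eqI_free[OF linear_map_comp[OF tensor_coset_linear[OF V W] f]
          linear_map_comp[OF tensor_coset_linear[OF V W] g] _ x(1)])
      (use eq in \<open>auto simp: pure_tensor_def\<close>)
  then show ?thesis by (simp add: x(2))
qed

text \<open>The existence half of the universal property. The linear extension \<open>h\<close> of a bilinear map to formal
  sums vanishes on the relators, hence on their span, so it descends to the cosets.\<close>
lemma tensor_lift:
  assumes V: "vectorspace K V" and W: "vectorspace K W" and b: "bilinear_map K V W P b"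
  shows tensor_lift_linear: "linear_map K (tensor_space K V W) P (tensor_lift K P b)"
    and tensor_lift_pure: "v \<in> carrier V \<Longrightarrow> w \<in> carrier W \<Longrightarrow>
      tensor_lift K P b (pure_tensor K V W v w) = b v w"
proof -
  interpret V: vectorspace K V by fact
  interpret W: vectorspace K W by fact
  have P: "vectorspace K P"
    using linear_map_vectorspace(2)[OF bilinear_mapD(1)[OF b V.M.zero_closed]] .
  interpret P: vectorspace K P by fact
  let ?F = "tensor_free K V W" and ?N = "tensor_null K V W" and ?T = "tensor_space K V W"
  let ?q = "\<lambda>f. ?N +>\<^bsub>?F\<^esub> f"
  interpret F: vectorspace K ?F using V.field_axioms by (rule free_space_vectorspace)
  note bl = linear_map_rules[OF bilinear_mapD(1)[OF b]] linear_map_rules[OF bilinear_mapD(2)[OF b]]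
  define h where "h = free_lift K P (\<lambda>s. b (fst s) (snd s))"
  have hlin: "linear_map K ?F P h"
    unfolding h_def by (rule free_lift_linear[OF P]) (auto simp: bl)
  interpret h: linear_map K ?F P h by (fact hlin)
  note h = linear_map_rules[OF hlin]
  have gen: "free_gen K (v, w) \<in> carrier ?F" if "v \<in> carrier V" "w \<in> carrier W" for v w
    using that by (intro free_gen_closed V.field_axioms) auto
  have hgen: "h (free_gen K (v, w)) = b v w" if "v \<in> carrier V" "w \<in> carrier W" for v w
    using that unfolding h_def by (subst free_lift_gen[OF P]) (auto simp: bl)
  have "tensor_relators K V W \<subseteq> h.ker"
    using tensor_null_submodule(3)[OF V W]
    unfolding h.ker_def
    by (auto simp: tensor_relators_def Let_def h hgen gen bl P.M.minus_other_side)
  then have "?N \<subseteq> h.ker"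
    unfolding tensor_null_def using h.ker_is_submodule by (rule F.span_is_subset)
  then have null: "h x = \<zero>\<^bsub>P\<^esub>" if "x \<in> ?N" for x using that by (auto simp: h.ker_def)
  have lift: "tensor_lift K P b (?q x) = h x" if "x \<in> carrier ?F" for x
    using image_coset_eq[OF hlin tensor_null_submodule(1)[OF V W] null that]
    by (simp add: tensor_lift_def h_def free_lift_def[abs_def])
  show "tensor_lift K P b (pure_tensor K V W v w) = b v w" if "v \<in> carrier V" "w \<in> carrier W"
    using that by (simp add: pure_tensor_def lift gen hgen)
  note q = linear_map_rules[OF tensor_coset_linear[OF V W]]
  show "linear_map K ?T P (tensor_lift K P b)"
  proof (rule linear_mapI)
    fix s t assume "s \<in> carrier ?T" "t \<in> carrier ?T"
    then obtain x y where "x \<in> carrier ?F" "s = ?q x" "y \<in> carrier ?F" "t = ?q y"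
      by (auto simp: tensor_space_carrier[OF V W])
    then show "tensor_lift K P b (s \<oplus>\<^bsub>?T\<^esub> t) = tensor_lift K P b s \<oplus>\<^bsub>P\<^esub> tensor_lift K P b t"
      by (simp flip: q(2) add: lift h)
  qed (auto simp: tensor_space_carrier[OF V W] lift h simp flip: q(3)
      intro: tensor_space_vectorspace(1)[OF V W] P)
qed

section \<open>Linear maps between tensor products\<close>

lemma tensor_map:
  assumes f: "linear_map K V P f" and g: "linear_map K W Q g"
  shows tensor_map_linear: "linear_map K (tensor_space K V W) (tensor_space K P Q) (tensor_map K P Q f g)"
    and tensor_map_pure: "v \<in> carrier V \<Longrightarrow> w \<in> carrier W \<Longrightarrow>
      tensor_map K P Q f g (pure_tensor K V W v w) = pure_tensor K P Q (f v) (g w)"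
proof -
  note sp = linear_map_vectorspace[OF f] linear_map_vectorspace[OF g]
  have "bilinear_map K V W (tensor_space K P Q) (\<lambda>v w. pure_tensor K P Q (f v) (g w))"
    by (rule bilinear_map_comp[OF pure_tensor_bilinear f g]) (fact sp)+
  note lift = tensor_lift[OF sp(1) sp(3) this]
  show "linear_map K (tensor_space K V W) (tensor_space K P Q) (tensor_map K P Q f g)"
    unfolding tensor_map_def by (fact lift)
  show "v \<in> carrier V \<Longrightarrow> w \<in> carrier W \<Longrightarrow>
      tensor_map K P Q f g (pure_tensor K V W v w) = pure_tensor K P Q (f v) (g w)"
    unfolding tensor_map_def by (fact lift)
qed

lemma tensor_flip:
  assumes V: "vectorspace K V" and W: "vectorspace K W"
  shows tensor_flip_linear: "linear_map K (tensor_space K V W) (tensor_space K W V) (tensor_flip K V W)"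
    and tensor_flip_pure: "v \<in> carrier V \<Longrightarrow> w \<in> carrier W \<Longrightarrow>
      tensor_flip K V W (pure_tensor K V W v w) = pure_tensor K W V w v"
proof -
  note lift = tensor_lift[OF V W bilinear_map_swap[OF pure_tensor_bilinear[OF W V]]]
  show "linear_map K (tensor_space K V W) (tensor_space K W V) (tensor_flip K V W)"
    unfolding tensor_flip_def by (fact lift)
  show "v \<in> carrier V \<Longrightarrow> w \<in> carrier W \<Longrightarrow>
      tensor_flip K V W (pure_tensor K V W v w) = pure_tensor K W V w v"
    unfolding tensor_flip_def by (fact lift)
qed

text \<open>Linearity in the first variable has to be known only at pure tensors in the second one: the laws
  for \<open>u\<close> are, for fixed \<open>u\<close>, equations between linear maps of the second variable.\<close>
lemma bilinear_map_tensorI: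
  assumes U: "vectorspace K U" and V: "vectorspace K V" and W: "vectorspace K W"
    and lin: "\<And>u. u \<in> carrier U \<Longrightarrow> linear_map K (tensor_space K V W) P (b u)"
    and pure: "\<And>v w. v \<in> carrier V \<Longrightarrow> w \<in> carrier W \<Longrightarrow>
      linear_map K U P (\<lambda>u. b u (pure_tensor K V W v w))"
  shows "bilinear_map K U (tensor_space K V W) P b"
  unfolding bilinear_map_def
proof (intro conjI ballI lin)
  interpret U: vectorspace K U by fact
  have P: "vectorspace K P" using linear_map_vectorspace(2)[OF lin[OF U.M.zero_closed]] .
  fix t assume t: "t \<in> carrier (tensor_space K V W)"
  show "linear_map K U P (\<lambda>u. b u t)"
  proof (rule linear_mapI[OF U P])
    fix u u' assume u: "u \<in> carrier U" "u' \<in> carrier U"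
    show "b (u \<oplus>\<^bsub>U\<^esub> u') t = b u t \<oplus>\<^bsub>P\<^esub> b u' t"
      by (rule tensor_linear_eqI[OF V W lin linear_map_add[OF lin lin] _ t])
        (use u in \<open>auto simp: linear_map_rules[OF pure]\<close>)
  next
    fix c u assume u: "c \<in> carrier K" "u \<in> carrier U"
    show "b (c \<odot>\<^bsub>U\<^esub> u) t = c \<odot>\<^bsub>P\<^esub> b u t"
      by (rule tensor_linear_eqI[OF V W lin linear_map_smult[OF lin] _ t])
        (use u in \<open>auto simp: linear_map_rules[OF pure]\<close>)
  qed (use linear_map_rules(1)[OF lin] t in auto)
qed

lemma tensor_assoc:
  assumes U: "vectorspace K U" and V: "vectorspace K V" and W: "vectorspace K W"
  shows tensor_assoc_linear: "linear_map K (tensor_space K U (tensor_space K V W))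
      (tensor_space K (tensor_space K U V) W) (tensor_assoc K U V W)"
    and tensor_assoc_pure: "u \<in> carrier U \<Longrightarrow> v \<in> carrier V \<Longrightarrow> w \<in> carrier W \<Longrightarrow>
      tensor_assoc K U V W (pure_tensor K U (tensor_space K V W) u (pure_tensor K V W v w)) =
        pure_tensor K (tensor_space K U V) W (pure_tensor K U V u v) w"
proof -
  let ?UV = "tensor_space K U V" and ?VW = "tensor_space K V W"
  let ?P = "tensor_space K ?UV W"
  let ?p = "\<lambda>u v w. pure_tensor K ?UV W (pure_tensor K U V u v) w"
  note VW = tensor_space_vectorspace(1)[OF V W] and UV = tensor_space_vectorspace(1)[OF U V]
  note bUV = pure_tensor_bilinear[OF U V] and bP = pure_tensor_bilinear[OF UV W]
  have inner: "bilinear_map K V W ?P (?p u)" if u: "u \<in> carrier U" for u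
    by (rule bilinear_map_comp[OF bP bilinear_mapD(1)[OF bUV u] linear_map_id[OF W]])
  note lift = tensor_lift[OF V W inner]
  have outer: "bilinear_map K U ?VW ?P (\<lambda>u. tensor_lift K ?P (?p u))"
  proof (rule bilinear_map_tensorI[OF U V W lift(1)])
    fix v w assume vw: "v \<in> carrier V" "w \<in> carrier W"
    have eq: "tensor_lift K ?P (?p u) (pure_tensor K V W v w) = ?p u v w" if "u \<in> carrier U" for u
      using lift(2)[OF that vw] .
    have lin: "linear_map K U ?P (\<lambda>u. ?p u v w)"
      using vw by (intro linear_map_comp[OF bilinear_mapD(2)[OF bUV] bilinear_mapD(2)[OF bP]])
    show "linear_map K U ?P (\<lambda>u. tensor_lift K ?P (?p u) (pure_tensor K V W v w))"
      by (rule linear_map_cong[OF lin eq])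
  qed
  have assoc: "tensor_assoc K U V W = tensor_lift K ?P (\<lambda>u. tensor_lift K ?P (?p u))"
    by (simp add: tensor_assoc_def Let_def)
  show "linear_map K (tensor_space K U ?VW) ?P (tensor_assoc K U V W)"
    unfolding assoc by (rule tensor_lift_linear[OF U VW outer])
  show "tensor_assoc K U V W (pure_tensor K U ?VW u (pure_tensor K V W v w)) = ?p u v w"
    if "u \<in> carrier U" "v \<in> carrier V" "w \<in> carrier W"
    using that unfolding assoc
    by (simp add: tensor_lift_pure[OF U VW outer] pure_tensor_closed[OF V W] lift(2))
qed

lemma tensor3_linear_eqI:
  assumes U: "vectorspace K U" and V: "vectorspace K V" and W: "vectorspace K W"
    and f: "linear_map K (tensor_space K U (tensor_space K V W)) P f"
    and g: "linear_map K (tensor_space K U (tensor_space K V W)) P g"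
    and eq: "\<And>u v w. u \<in> carrier U \<Longrightarrow> v \<in> carrier V \<Longrightarrow> w \<in> carrier W \<Longrightarrow>
      f (pure_tensor K U (tensor_space K V W) u (pure_tensor K V W v w)) =
      g (pure_tensor K U (tensor_space K V W) u (pure_tensor K V W v w))"
    and t: "t \<in> carrier (tensor_space K U (tensor_space K V W))"
  shows "f t = g t"
proof (rule tensor_linear_eqI[OF U tensor_space_vectorspace(1)[OF V W] f g _ t])
  fix u s assume u: "u \<in> carrier U" and s: "s \<in> carrier (tensor_space K V W)"
  note p = bilinear_mapD(1)[OF pure_tensor_bilinear[OF U tensor_space_vectorspace(1)[OF V W]] u]
  show "f (pure_tensor K U (tensor_space K V W) u s) = g (pure_tensor K U (tensor_space K V W) u s)"
    by (rule tensor_linear_eqI[OF V W linear_map_comp[OF p f] linear_map_comp[OF p g] eq[OF u] s])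
qed

lemma tensor_map_comp:
  assumes f: "linear_map K V P f" and g: "linear_map K W Q g"
    and f': "linear_map K P S f'" and g': "linear_map K Q T g'"
    and t: "t \<in> carrier (tensor_space K V W)"
  shows "tensor_map K S T f' g' (tensor_map K P Q f g t) =
    tensor_map K S T (\<lambda>v. f' (f v)) (\<lambda>w. g' (g w)) t"
proof -
  note ff = linear_map_comp[OF f f'] and gg = linear_map_comp[OF g g']
  show ?thesis
    by (rule tensor_linear_eqI[OF _ _
          linear_map_comp[OF tensor_map_linear[OF f g] tensor_map_linear[OF f' g']]
          tensor_map_linear[OF ff gg] _ t])
      (auto simp: tensor_map_pure[OF f g] tensor_map_pure[OF f' g'] tensor_map_pure[OF ff gg]
        linear_map_rules(1)[OF f] linear_map_rules(1)[OF g]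
        intro: linear_map_vectorspace[OF f] linear_map_vectorspace[OF g])
qed

lemma tensor_flip_map:
  assumes f: "linear_map K V P f" and g: "linear_map K W Q g"
    and t: "t \<in> carrier (tensor_space K V W)"
  shows "tensor_flip K P Q (tensor_map K P Q f g t) = tensor_map K Q P g f (tensor_flip K V W t)"
proof -
  note V = linear_map_vectorspace(1)[OF f] and P = linear_map_vectorspace(2)[OF f]
    and W = linear_map_vectorspace(1)[OF g] and Q = linear_map_vectorspace(2)[OF g]
  show ?thesis
    by (rule tensor_linear_eqI[OF V W
          linear_map_comp[OF tensor_map_linear[OF f g] tensor_flip_linear[OF P Q]]
          linear_map_comp[OF tensor_flip_linear[OF V W] tensor_map_linear[OF g f]] _ t])
      (simp add: tensor_map_pure[OF f g] tensor_map_pure[OF g f] tensor_flip_pure[OF V W]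
        tensor_flip_pure[OF P Q] linear_map_rules(1)[OF f] linear_map_rules(1)[OF g])
qed

section \<open>The pre-Lie coproduct of a Rota-Baxter coproduct of weight -1\<close>

locale rota_baxter_weight_minus_one =
  rota_baxter_hom_coass_coder_pair K L \<Delta> \<phi> \<alpha> R "\<ominus>\<^bsub>K\<^esub> \<one>\<^bsub>K\<^esub>"
  for K :: "('k, 'r) ring_scheme" and L :: "('k, 'l, 'm) module_scheme" and \<Delta> \<phi> \<alpha> R
begin

abbreviation pure_LL (infixl "\<otimes>\<^sub>L" 75) where "x \<otimes>\<^sub>L y \<equiv> pure_tensor K L L x y"

abbreviation "L_LL \<equiv> tensor_space K L LL"

text \<open>The operator with \<open>x \<otimes> y \<mapsto> R x \<otimes> y - R y \<otimes> x - x \<otimes> y\<close> through which the new coproduct factors as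
  \<open>pre_lie_map \<circ> \<Delta>\<close>.\<close>
definition pre_lie_map :: "('l \<times> 'l \<Rightarrow> 'k) set \<Rightarrow> ('l \<times> 'l \<Rightarrow> 'k) set" where
  "pre_lie_map t = tensor_map K L L R (\<lambda>x. x) t
    \<ominus>\<^bsub>LL\<^esub> tensor_flip K L L (tensor_map K L L (\<lambda>x. x) R t) \<ominus>\<^bsub>LL\<^esub> t"

text \<open>Dually, this is the second product \<open>R x y + x R y - x y\<close> of a Rota-Baxter algebra of
  weight \<open>-1\<close> (its double).\<close>
definition double_map :: "('l \<times> 'l \<Rightarrow> 'k) set \<Rightarrow> ('l \<times> 'l \<Rightarrow> 'k) set" where
  "double_map t = tensor_map K L L (\<lambda>x. x) R t \<oplus>\<^bsub>LL\<^esub> tensor_map K L L R (\<lambda>x. x) t \<ominus>\<^bsub>LL\<^esub> t"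

lemma spaces: "vectorspace K L" "vectorspace K LL" "vectorspace K LLL" "vectorspace K L_LL"
  using vectorspace_axioms by (auto intro!: tensor_space_vectorspace)

interpretation LL: vectorspace K LL by (fact spaces)
interpretation LLL: vectorspace K LLL by (fact spaces)
interpretation L_LL: vectorspace K L_LL by (fact spaces)

lemmas id_linear = linear_map_id[OF spaces(1)]
  and id_LL_linear = linear_map_id[OF spaces(2)]

lemmas flip_linear = tensor_flip_linear[OF spaces(1,1)] tensor_flip_linear[OF spaces(1,2)]
  tensor_flip_linear[OF spaces(2,1)]

lemmas flip_pure = tensor_flip_pure[OF spaces(1,1)] tensor_flip_pure[OF spaces(1,2)]
  tensor_flip_pure[OF spaces(2,1)]

lemmas closed = linear_map_rules(1)[OF coproduct_linear] linear_map_rules(1)[OF coder_linear]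
  linear_map_rules(1)[OF twist_linear] linear_map_rules(1)[OF rota_baxter_linear]
  pure_tensor_closed[OF spaces(1,1)] pure_tensor_closed[OF spaces(1,2)]
  pure_tensor_closed[OF spaces(2,1)]

lemmas pure_expand =
  linear_map_rules(2,4)[OF bilinear_mapD(1)[OF pure_tensor_bilinear[OF spaces(1,1)]]]
  linear_map_rules(2,4)[OF bilinear_mapD(1)[OF pure_tensor_bilinear[OF spaces(1,2)]]]
  linear_map_rules(2,4)[OF bilinear_mapD(2)[OF pure_tensor_bilinear[OF spaces(2,1)]]]

lemmas R1_linear = tensor_map_linear[OF rota_baxter_linear id_linear]
  and R2_linear = tensor_map_linear[OF id_linear rota_baxter_linear]

lemma pre_lie_map_linear: "linear_map K LL LL pre_lie_map"
  unfolding pre_lie_map_def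
  by (rule linear_map_minus[OF
        linear_map_minus[OF R1_linear linear_map_comp[OF R2_linear flip_linear(1)]] id_LL_linear])

lemma double_map_linear: "linear_map K LL LL double_map"
  unfolding double_map_def
  by (rule linear_map_minus[OF linear_map_add[OF R2_linear R1_linear] id_LL_linear])

lemma pre_lie_map_pure:
  assumes "x \<in> carrier L" "y \<in> carrier L"
  shows "pre_lie_map (x \<otimes>\<^sub>L y) = R x \<otimes>\<^sub>L y \<ominus>\<^bsub>LL\<^esub> R y \<otimes>\<^sub>L x \<ominus>\<^bsub>LL\<^esub> x \<otimes>\<^sub>L y"
  using assms by (simp add: pre_lie_map_def tensor_map_pure[OF rota_baxter_linear id_linear]
      tensor_map_pure[OF id_linear rota_baxter_linear] flip_pure closed)

lemma double_map_pure:
  assumes "x \<in> carrier L" "y \<in> carrier L"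
  shows "double_map (x \<otimes>\<^sub>L y) = x \<otimes>\<^sub>L R y \<oplus>\<^bsub>LL\<^esub> R x \<otimes>\<^sub>L y \<ominus>\<^bsub>LL\<^esub> x \<otimes>\<^sub>L y"
  using assms by (simp add: double_map_def tensor_map_pure[OF rota_baxter_linear id_linear]
      tensor_map_pure[OF id_linear rota_baxter_linear] closed)

text \<open>Dually: the pre-Lie product and the double product have the same commutator. This is what
  makes the Rota-Baxter identity applicable to the new coproduct.\<close>
lemma pre_lie_map_antisymmetrized:
  assumes "t \<in> carrier LL"
  shows "pre_lie_map t \<ominus>\<^bsub>LL\<^esub> tensor_flip K L L (pre_lie_map t) =
    double_map t \<ominus>\<^bsub>LL\<^esub> tensor_flip K L L (double_map t)"
  by (rule tensor_linear_eqI[OF spaces(1,1)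
        linear_map_minus[OF pre_lie_map_linear linear_map_comp[OF pre_lie_map_linear flip_linear(1)]]
        linear_map_minus[OF double_map_linear linear_map_comp[OF double_map_linear flip_linear(1)]] _ assms])
    (simp add: pre_lie_map_pure double_map_pure closed linear_map_rules(2,4)[OF flip_linear(1)] flip_pure
      LL.M.minus_collect LL.M.minus_eq_iff LL.M.a_ac)

text \<open>The Rota-Baxter identity of weight \<open>-1\<close>.\<close>
lemma double_map_coproduct:
  assumes "l \<in> carrier L"
  shows "double_map (\<Delta> (R l)) = tensor_map K L L R R (\<Delta> l)"
proof -
  have "\<Delta> (R l) \<in> carrier LL" using assms by (simp add: closed)
  moreover have "tensor_map K L L f g t \<in> carrier LL"
    if "linear_map K L L f" "linear_map K L L g" "t \<in> carrier LL" for f g t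
    using linear_map_rules(1)[OF tensor_map_linear] that by blast
  ultimately show ?thesis
    using assms by (simp add: rota_baxter double_map_def LL.smult_l_minus a_minus_def)
qed

text \<open>\<open>R\<close> commutes with \<open>\<phi>\<close> and \<open>\<alpha>\<close>. The middle term of \<open>pre_lie_map\<close> contains the flip, which exchanges
  \<open>\<phi> \<otimes> \<alpha>\<close> and \<open>\<alpha> \<otimes> \<phi>\<close> and therefore commutes with their sum.\<close>
lemma pre_lie_map_coder:
  assumes t: "t \<in> carrier LL"
  shows "pre_lie_map (tensor_map K L L \<phi> \<alpha> t \<oplus>\<^bsub>LL\<^esub> tensor_map K L L \<alpha> \<phi> t) =
    tensor_map K L L \<phi> \<alpha> (pre_lie_map t) \<oplus>\<^bsub>LL\<^esub> tensor_map K L L \<alpha> \<phi> (pre_lie_map t)"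
proof -
  note lin = tensor_map_linear[OF coder_linear twist_linear]
    tensor_map_linear[OF twist_linear coder_linear]
  note pure = tensor_map_pure[OF coder_linear twist_linear]
    tensor_map_pure[OF twist_linear coder_linear]
  show ?thesis
  proof (rule tensor_linear_eqI[OF spaces(1,1) linear_map_comp[OF linear_map_add[OF lin] pre_lie_map_linear]
        linear_map_add[OF linear_map_comp[OF pre_lie_map_linear lin(1)]
          linear_map_comp[OF pre_lie_map_linear lin(2)]] _ t])
    fix x y assume xy: "x \<in> carrier L" "y \<in> carrier L"
    have "pre_lie_map (tensor_map K L L \<phi> \<alpha> (x \<otimes>\<^sub>L y) \<oplus>\<^bsub>LL\<^esub> tensor_map K L L \<alpha> \<phi> (x \<otimes>\<^sub>L y)) =
        (R (\<phi> x) \<otimes>\<^sub>L \<alpha> y \<ominus>\<^bsub>LL\<^esub> \<alpha> (R y) \<otimes>\<^sub>L \<phi> x \<ominus>\<^bsub>LL\<^esub> \<phi> x \<otimes>\<^sub>L \<alpha> y) \<oplus>\<^bsub>LL\<^esub>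
        (\<alpha> (R x) \<otimes>\<^sub>L \<phi> y \<ominus>\<^bsub>LL\<^esub> R (\<phi> y) \<otimes>\<^sub>L \<alpha> x \<ominus>\<^bsub>LL\<^esub> \<alpha> x \<otimes>\<^sub>L \<phi> y)"
      using xy by (simp add: pure closed pre_lie_map_pure linear_map_rules(2)[OF pre_lie_map_linear]
          rota_baxter_twist)
    also have "\<dots> =
        (R (\<phi> x) \<otimes>\<^sub>L \<alpha> y \<ominus>\<^bsub>LL\<^esub> R (\<phi> y) \<otimes>\<^sub>L \<alpha> x \<ominus>\<^bsub>LL\<^esub> \<phi> x \<otimes>\<^sub>L \<alpha> y) \<oplus>\<^bsub>LL\<^esub>
        (\<alpha> (R x) \<otimes>\<^sub>L \<phi> y \<ominus>\<^bsub>LL\<^esub> \<alpha> (R y) \<otimes>\<^sub>L \<phi> x \<ominus>\<^bsub>LL\<^esub> \<alpha> x \<otimes>\<^sub>L \<phi> y)"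
      by (rule LL.M.exchange_subtrahends) (simp_all add: closed xy)
    also have "\<dots> = tensor_map K L L \<phi> \<alpha> (pre_lie_map (x \<otimes>\<^sub>L y)) \<oplus>\<^bsub>LL\<^esub>
        tensor_map K L L \<alpha> \<phi> (pre_lie_map (x \<otimes>\<^sub>L y))"
      using xy by (simp add: pure closed pre_lie_map_pure linear_map_rules(4)[OF lin(1)]
          linear_map_rules(4)[OF lin(2)] rota_baxter_coder)
    finally show "pre_lie_map (tensor_map K L L \<phi> \<alpha> (x \<otimes>\<^sub>L y) \<oplus>\<^bsub>LL\<^esub> tensor_map K L L \<alpha> \<phi> (x \<otimes>\<^sub>L y)) =
      tensor_map K L L \<phi> \<alpha> (pre_lie_map (x \<otimes>\<^sub>L y)) \<oplus>\<^bsub>LL\<^esub>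
        tensor_map K L L \<alpha> \<phi> (pre_lie_map (x \<otimes>\<^sub>L y))" .
  qed
qed

lemma pre_lie_coproduct_linear: "linear_map K L LL (\<lambda>l. pre_lie_map (\<Delta> l))"
  by (rule linear_map_comp[OF coproduct_linear pre_lie_map_linear])

lemma pre_lie_coproduct_coder:
  assumes "l \<in> carrier L"
  shows "pre_lie_map (\<Delta> (\<phi> l)) = tensor_map K L L \<phi> \<alpha> (pre_lie_map (\<Delta> l)) \<oplus>\<^bsub>LL\<^esub>
    tensor_map K L L \<alpha> \<phi> (pre_lie_map (\<Delta> l))"
  using assms by (simp add: coder pre_lie_map_coder closed)

lemma flip12_linear: "linear_map K LLL LLL flip12"
  unfolding flip12_def by (rule tensor_map_linear[OF flip_linear(1) id_linear])

lemma flip12_pure: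
  "t \<in> carrier LL \<Longrightarrow> z \<in> carrier L \<Longrightarrow>
    flip12 (pure_tensor K LL L t z) = pure_tensor K LL L (tensor_flip K L L t) z"
  unfolding flip12_def by (rule tensor_map_pure[OF flip_linear(1) id_linear])

lemma pre_lie_map_antisymmetrized12:
  assumes s: "s \<in> carrier LLL"
  shows "tensor_map K LL L pre_lie_map (\<lambda>x. x) s \<ominus>\<^bsub>LLL\<^esub> flip12 (tensor_map K LL L pre_lie_map (\<lambda>x. x) s) =
    tensor_map K LL L double_map (\<lambda>x. x) s \<ominus>\<^bsub>LLL\<^esub> flip12 (tensor_map K LL L double_map (\<lambda>x. x) s)"
proof -
  note A1 = tensor_map_linear[OF pre_lie_map_linear id_linear]
    and B1 = tensor_map_linear[OF double_map_linear id_linear]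
  show ?thesis
  proof (rule tensor_linear_eqI[OF spaces(2,1) _ _ _ s])
    show "linear_map K LLL LLL (\<lambda>s. tensor_map K LL L pre_lie_map (\<lambda>x. x) s \<ominus>\<^bsub>LLL\<^esub>
        flip12 (tensor_map K LL L pre_lie_map (\<lambda>x. x) s))"
      by (rule linear_map_minus[OF A1 linear_map_comp[OF A1 flip12_linear]])
    show "linear_map K LLL LLL (\<lambda>s. tensor_map K LL L double_map (\<lambda>x. x) s \<ominus>\<^bsub>LLL\<^esub>
        flip12 (tensor_map K LL L double_map (\<lambda>x. x) s))"
      by (rule linear_map_minus[OF B1 linear_map_comp[OF B1 flip12_linear]])
  next
    fix t z assume tz: "t \<in> carrier LL" "z \<in> carrier L"
    have "pure_tensor K LL L (pre_lie_map t \<ominus>\<^bsub>LL\<^esub> tensor_flip K L L (pre_lie_map t)) z =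
        pure_tensor K LL L (double_map t \<ominus>\<^bsub>LL\<^esub> tensor_flip K L L (double_map t)) z"
      using tz by (simp add: pre_lie_map_antisymmetrized)
    then show "tensor_map K LL L pre_lie_map (\<lambda>x. x) (pure_tensor K LL L t z) \<ominus>\<^bsub>LLL\<^esub>
        flip12 (tensor_map K LL L pre_lie_map (\<lambda>x. x) (pure_tensor K LL L t z)) =
      tensor_map K LL L double_map (\<lambda>x. x) (pure_tensor K LL L t z) \<ominus>\<^bsub>LLL\<^esub>
        flip12 (tensor_map K LL L double_map (\<lambda>x. x) (pure_tensor K LL L t z))"
      using tz by (simp add: tensor_map_pure[OF pre_lie_map_linear id_linear]
          tensor_map_pure[OF double_map_linear id_linear] flip12_pure pure_expand
          linear_map_rules(1)[OF pre_lie_map_linear] linear_map_rules(1)[OF double_map_linear]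
          linear_map_rules(1)[OF flip_linear(1)])
  qed
qed

text \<open>For \<open>d = (\<alpha> \<otimes> \<Delta>) (\<Delta> l)\<close> this is not \<open>(\<Delta>' \<otimes> \<alpha>) (\<Delta>' l)\<close> with \<open>\<Delta>' = pre_lie_map \<circ> \<Delta>\<close>, but
  what it becomes when its outer \<open>pre_lie_map \<otimes> 1\<close> is replaced by \<open>double_map \<otimes> 1\<close>. The image under
  \<open>1 - \<tau>\<^sup>1\<^sup>2\<close> is the same, and now the Rota-Baxter identity has removed every \<open>\<Delta> (R _)\<close>.\<close>
definition left_iterate where
  "left_iterate d = tensor_map K LL L (tensor_map K L L R R) (\<lambda>x. x) (tensor_assoc K L L L d)
    \<ominus>\<^bsub>LLL\<^esub> tensor_map K LL L (tensor_map K L L R R) (\<lambda>x. x) (tensor_flip K L LL d)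
    \<ominus>\<^bsub>LLL\<^esub> tensor_map K LL L double_map (\<lambda>x. x) (tensor_assoc K L L L d)"

text \<open>For the same \<open>d\<close> this is \<open>(\<alpha> \<otimes> \<Delta>') (\<Delta>' l)\<close>. Both iterates are written as linear operators applied to
  an arbitrary \<open>d\<close>, because operators can be compared on pure tensors, whereas \<open>d\<close> itself need not be
  one.\<close>
definition right_iterate where
  "right_iterate d = tensor_assoc K L L L (tensor_map K L LL (\<lambda>x. x) pre_lie_map
    (tensor_map K L LL R (\<lambda>x. x) d
      \<ominus>\<^bsub>L_LL\<^esub> tensor_flip K LL L (tensor_map K LL L (\<lambda>x. x) R (tensor_assoc K L L L d))
      \<ominus>\<^bsub>L_LL\<^esub> d))"

lemmas assoc_linear = tensor_assoc_linear[OF spaces(1,1,1)]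

lemmas RR_linear = tensor_map_linear[OF rota_baxter_linear rota_baxter_linear]

lemma left_iterate_linear: "linear_map K L_LL LLL left_iterate"
proof -
  note RR1 = tensor_map_linear[OF RR_linear id_linear]
    and B1 = tensor_map_linear[OF double_map_linear id_linear]
  show ?thesis
    unfolding left_iterate_def
    by (rule linear_map_minus[OF linear_map_minus[OF linear_map_comp[OF assoc_linear RR1]
          linear_map_comp[OF flip_linear(2) RR1]] linear_map_comp[OF assoc_linear B1]])
qed

lemma right_iterate_linear: "linear_map K L_LL LLL right_iterate"
proof -
  note R1 = tensor_map_linear[OF rota_baxter_linear id_LL_linear]
    and R3 = linear_map_comp[OF assoc_linear tensor_map_linear[OF id_LL_linear rota_baxter_linear]]
    and A23 = tensor_map_linear[OF id_linear pre_lie_map_linear]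
  show ?thesis
    unfolding right_iterate_def
    by (rule linear_map_comp[OF linear_map_comp[OF linear_map_minus[OF
            linear_map_minus[OF R1 linear_map_comp[OF R3 flip_linear(3)]]
            linear_map_id[OF spaces(4)]] A23] assoc_linear])
qed

text \<open>The right-hand side is visibly symmetric in the first two tensor factors.\<close>
lemma iterate_difference_pure:
  assumes xyz: "x \<in> carrier L" "y \<in> carrier L" "z \<in> carrier L"
  defines "T \<equiv> \<lambda>x y z. pure_tensor K LL L (x \<otimes>\<^sub>L y) z"
    and "d \<equiv> pure_tensor K L LL x (y \<otimes>\<^sub>L z)"
  shows "left_iterate d \<ominus>\<^bsub>LLL\<^esub> right_iterate d =
    (T (R x) (R z) y \<oplus>\<^bsub>LLL\<^esub> T (R z) (R x) y)
      \<ominus>\<^bsub>LLL\<^esub> (T (R y) (R z) x \<oplus>\<^bsub>LLL\<^esub> T (R z) (R y) x)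
      \<ominus>\<^bsub>LLL\<^esub> (T x (R z) y \<oplus>\<^bsub>LLL\<^esub> T (R z) x y)"
proof -
  have T: "T a b c \<in> carrier LLL" if "a \<in> carrier L" "b \<in> carrier L" "c \<in> carrier L" for a b c
    using that by (simp add: T_def closed)
  have assoc: "tensor_assoc K L L L (pure_tensor K L LL a (b \<otimes>\<^sub>L c)) = T a b c"
    if "a \<in> carrier L" "b \<in> carrier L" "c \<in> carrier L" for a b c
    using that unfolding T_def by (rule tensor_assoc_pure[OF spaces(1,1,1)])
  have RRT: "tensor_map K LL L (tensor_map K L L R R) (\<lambda>x. x) (T a b c) = T (R a) (R b) c"
    if "a \<in> carrier L" "b \<in> carrier L" "c \<in> carrier L" for a b c
    using that unfolding T_def
    by (simp add: tensor_map_pure[OF RR_linear id_linear]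
        tensor_map_pure[OF rota_baxter_linear rota_baxter_linear] closed)
  have BT: "tensor_map K LL L double_map (\<lambda>x. x) (T a b c) =
      T a (R b) c \<oplus>\<^bsub>LLL\<^esub> T (R a) b c \<ominus>\<^bsub>LLL\<^esub> T a b c"
    if "a \<in> carrier L" "b \<in> carrier L" "c \<in> carrier L" for a b c
    using that unfolding T_def
    by (simp add: tensor_map_pure[OF double_map_linear id_linear] double_map_pure closed pure_expand)
  have AT: "tensor_assoc K L L L (tensor_map K L LL (\<lambda>x. x) pre_lie_map (pure_tensor K L LL a (b \<otimes>\<^sub>L c))) =
      T a (R b) c \<ominus>\<^bsub>LLL\<^esub> T a (R c) b \<ominus>\<^bsub>LLL\<^esub> T a b c"
    if "a \<in> carrier L" "b \<in> carrier L" "c \<in> carrier L" for a b c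
    using that
    by (simp add: tensor_map_pure[OF id_linear pre_lie_map_linear] pre_lie_map_pure closed pure_expand
        linear_map_rules(4)[OF assoc_linear] assoc)
  have flip: "tensor_flip K L LL d = T y z x"
    using xyz by (simp add: d_def T_def flip_pure closed)
  have rot: "tensor_flip K LL L (tensor_map K LL L (\<lambda>x. x) R (T x y z)) =
      pure_tensor K L LL (R z) (x \<otimes>\<^sub>L y)"
    using xyz unfolding T_def
    by (simp add: tensor_map_pure[OF id_LL_linear rota_baxter_linear] flip_pure closed)
  have left: "left_iterate d = T (R x) (R y) z \<ominus>\<^bsub>LLL\<^esub> T (R y) (R z) x
      \<ominus>\<^bsub>LLL\<^esub> (T x (R y) z \<oplus>\<^bsub>LLL\<^esub> T (R x) y z \<ominus>\<^bsub>LLL\<^esub> T x y z)"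
    using xyz by (simp add: left_iterate_def flip assoc RRT BT d_def[symmetric])
      (simp add: d_def assoc RRT BT)
  note A1 = linear_map_comp[OF tensor_map_linear[OF id_linear pre_lie_map_linear] assoc_linear]
  have R1: "tensor_map K L LL R (\<lambda>x. x) d = pure_tensor K L LL (R x) (y \<otimes>\<^sub>L z)"
    using xyz by (simp add: d_def tensor_map_pure[OF rota_baxter_linear id_LL_linear] closed)
  have right: "right_iterate d = T (R x) (R y) z \<ominus>\<^bsub>LLL\<^esub> T (R x) (R z) y \<ominus>\<^bsub>LLL\<^esub> T (R x) y z
      \<ominus>\<^bsub>LLL\<^esub> (T (R z) (R x) y \<ominus>\<^bsub>LLL\<^esub> T (R z) (R y) x \<ominus>\<^bsub>LLL\<^esub> T (R z) x y)
      \<ominus>\<^bsub>LLL\<^esub> (T x (R y) z \<ominus>\<^bsub>LLL\<^esub> T x (R z) y \<ominus>\<^bsub>LLL\<^esub> T x y z)"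
    unfolding right_iterate_def R1 unfolding d_def
    using xyz by (simp add: assoc rot linear_map_rules(4)[OF A1] closed AT)
  show ?thesis
    unfolding left right by (rule LLL.M.associator_difference) (simp_all add: T closed xyz)
qed

lemma iterate_difference_symmetric:
  assumes d: "d \<in> carrier L_LL"
  shows "flip12 (left_iterate d \<ominus>\<^bsub>LLL\<^esub> right_iterate d) = left_iterate d \<ominus>\<^bsub>LLL\<^esub> right_iterate d"
proof (rule tensor3_linear_eqI[OF spaces(1,1,1) _ _ _ d])
  show lin: "linear_map K L_LL LLL (\<lambda>d. left_iterate d \<ominus>\<^bsub>LLL\<^esub> right_iterate d)"
    by (rule linear_map_minus[OF left_iterate_linear right_iterate_linear])
  show "linear_map K L_LL LLL (\<lambda>d. flip12 (left_iterate d \<ominus>\<^bsub>LLL\<^esub> right_iterate d))"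
    by (rule linear_map_comp[OF lin flip12_linear])
next
  fix x y z assume xyz: "x \<in> carrier L" "y \<in> carrier L" "z \<in> carrier L"
  let ?d = "pure_tensor K L LL x (y \<otimes>\<^sub>L z)"
  show "flip12 (left_iterate ?d \<ominus>\<^bsub>LLL\<^esub> right_iterate ?d) = left_iterate ?d \<ominus>\<^bsub>LLL\<^esub> right_iterate ?d"
    using xyz
    by (simp add: iterate_difference_pure linear_map_rules(2,4)[OF flip12_linear] flip12_pure
        flip_pure closed LLL.M.a_comm)
qed

text \<open>Wherever \<open>R\<close> occurs in \<open>pre_lie_map (\<Delta> l)\<close>, it stands in the first tensor factor, where \<open>\<Delta>\<close> is
  applied next and \<open>double_map\<close> after it; this is the situation of \<open>double_map_coproduct\<close> (step \<open>BR\<close>). Hom-coassociativity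
  then expresses the remaining iterates by \<open>d\<close>.\<close>
lemma left_iterate_via_double_map:
  assumes l: "l \<in> carrier L"
  defines "d \<equiv> tensor_map K L LL \<alpha> \<Delta> (\<Delta> l)"
  shows "tensor_map K LL L double_map (\<lambda>x. x) (tensor_map K LL L \<Delta> \<alpha> (pre_lie_map (\<Delta> l))) = left_iterate d"
proof -
  have D: "\<Delta> l \<in> carrier LL" using l by (rule closed)
  note B1 = tensor_map_linear[OF double_map_linear id_linear]
  note Da = tensor_map_linear[OF coproduct_linear twist_linear]
  note BDa = linear_map_comp[OF Da B1]
  have assoc: "tensor_map K LL L \<Delta> \<alpha> (\<Delta> l) = tensor_assoc K L L L d"
    using hom_coassociative[OF l] by (simp add: d_def twist_coproduct_def coproduct_twist_def)
  have flip: "tensor_map K LL L \<Delta> \<alpha> (tensor_flip K L L (\<Delta> l)) = tensor_flip K L LL d"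
    unfolding d_def by (rule tensor_flip_map[OF twist_linear coproduct_linear D, symmetric])
  have BR: "tensor_map K LL L double_map (\<lambda>x. x) (tensor_map K LL L \<Delta> \<alpha> (tensor_map K L L R (\<lambda>x. x) t)) =
      tensor_map K LL L (tensor_map K L L R R) (\<lambda>x. x) (tensor_map K LL L \<Delta> \<alpha> t)"
    if t: "t \<in> carrier LL" for t
    by (rule tensor_linear_eqI[OF spaces(1,1) linear_map_comp[OF R1_linear BDa]
          linear_map_comp[OF Da tensor_map_linear[OF RR_linear id_linear]] _ t])
      (simp add: tensor_map_pure[OF rota_baxter_linear id_linear]
        tensor_map_pure[OF coproduct_linear twist_linear]
        tensor_map_pure[OF double_map_linear id_linear] tensor_map_pure[OF RR_linear id_linear]
        closed double_map_coproduct)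
  have flipR: "tensor_flip K L L (tensor_map K L L (\<lambda>x. x) R (\<Delta> l)) =
      tensor_map K L L R (\<lambda>x. x) (tensor_flip K L L (\<Delta> l))"
    by (rule tensor_flip_map[OF id_linear rota_baxter_linear D])
  show ?thesis
    unfolding pre_lie_map_def left_iterate_def assoc[symmetric] flip[symmetric] flipR
    using D by (simp add: linear_map_rules(4)[OF BDa] linear_map_rules(1)[OF R1_linear]
        linear_map_rules(1)[OF flip_linear(1)] BR)
qed

lemma right_iterate_eq:
  assumes l: "l \<in> carrier L"
  defines "d \<equiv> tensor_map K L LL \<alpha> \<Delta> (\<Delta> l)"
  shows "tensor_assoc K L L L (tensor_map K L LL (\<lambda>x. x) pre_lie_map (tensor_map K L LL \<alpha> \<Delta> (pre_lie_map (\<Delta> l)))) =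
    right_iterate d"
proof -
  have D: "\<Delta> l \<in> carrier LL" using l by (rule closed)
  note aD = tensor_map_linear[OF twist_linear coproduct_linear]
  note Da = tensor_map_linear[OF coproduct_linear twist_linear]
  have assoc: "tensor_map K LL L \<Delta> \<alpha> (\<Delta> l) = tensor_assoc K L L L d"
    using hom_coassociative[OF l] by (simp add: d_def twist_coproduct_def coproduct_twist_def)
  have aR: "tensor_map K L LL \<alpha> \<Delta> (tensor_map K L L R (\<lambda>x. x) (\<Delta> l)) =
      tensor_map K L LL R (\<lambda>x. x) d"
    unfolding d_def
    by (rule tensor_linear_eqI[OF spaces(1,1) linear_map_comp[OF R1_linear aD]
          linear_map_comp[OF aD tensor_map_linear[OF rota_baxter_linear id_LL_linear]] _ D])
      (simp add: tensor_map_pure[OF rota_baxter_linear id_linear]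
        tensor_map_pure[OF twist_linear coproduct_linear] tensor_map_pure[OF rota_baxter_linear id_LL_linear]
        closed rota_baxter_twist)
  have flipR: "tensor_map K L LL \<alpha> \<Delta> (tensor_flip K L L (tensor_map K L L (\<lambda>x. x) R (\<Delta> l))) =
      tensor_flip K LL L (tensor_map K LL L (\<lambda>x. x) R (tensor_map K LL L \<Delta> \<alpha> (\<Delta> l)))"
    by (rule tensor_linear_eqI[OF spaces(1,1)
          linear_map_comp[OF R2_linear linear_map_comp[OF flip_linear(1) aD]]
          linear_map_comp[OF Da linear_map_comp[OF tensor_map_linear[OF id_LL_linear rota_baxter_linear] flip_linear(3)]]
          _ D])
      (simp add: tensor_map_pure[OF id_linear rota_baxter_linear] tensor_map_pure[OF twist_linear coproduct_linear]
        tensor_map_pure[OF coproduct_linear twist_linear] tensor_map_pure[OF id_LL_linear rota_baxter_linear]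
        flip_pure closed rota_baxter_twist)
  show ?thesis
    unfolding pre_lie_map_def[of "\<Delta> l"] right_iterate_def assoc[symmetric] flipR[symmetric] aR[symmetric]
    using D by (simp add: d_def linear_map_rules(4)[OF aD] linear_map_rules(1)[OF R1_linear]
        linear_map_rules(1)[OF R2_linear] linear_map_rules(1)[OF flip_linear(1)])
qed

text \<open>In the pre-Lie identity the first iterate may be replaced by \<open>left_iterate d\<close>, and then the symmetry
  of \<open>left_iterate d - right_iterate d\<close> finishes the proof.\<close>
lemma pre_lie_coproduct_pair: "hom_pre_lie_coder_pair K L (\<lambda>l. pre_lie_map (\<Delta> l)) \<phi> \<alpha>"
proof -
  have pair: "coproduct_pair K L (\<lambda>l. pre_lie_map (\<Delta> l)) \<phi> \<alpha>"
    by (rule coproduct_pair.intro[OF vectorspace_char_0_axioms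
          coproduct_pair_axioms.intro[OF pre_lie_coproduct_linear coder_linear twist_linear]])
  then interpret N: coproduct_pair K L "\<lambda>l. pre_lie_map (\<Delta> l)" \<phi> \<alpha> .
  show ?thesis
  proof (rule hom_pre_lie_coder_pair.intro[OF coder_pair.intro[OF pair coder_pair_axioms.intro]
        hom_pre_lie_coder_pair_axioms.intro], fact pre_lie_coproduct_coder)
    fix l assume l: "l \<in> carrier L"
    have D: "\<Delta> l \<in> carrier LL" using l by (rule closed)
    define d where "d = tensor_map K L LL \<alpha> \<Delta> (\<Delta> l)"
    define s where "s = tensor_map K LL L \<Delta> \<alpha> (pre_lie_map (\<Delta> l))"
    define u where "u = tensor_map K LL L pre_lie_map (\<lambda>x. x) s"
    have d: "d \<in> carrier L_LL"
      unfolding d_def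
      using D by (rule linear_map_rules(1)[OF tensor_map_linear[OF twist_linear coproduct_linear]])
    have AD: "pre_lie_map (\<Delta> l) \<in> carrier LL" using D by (rule linear_map_rules(1)[OF pre_lie_map_linear])
    have s: "s \<in> carrier LLL"
      unfolding s_def
      using AD by (rule linear_map_rules(1)[OF tensor_map_linear[OF coproduct_linear twist_linear]])
    have u: "u \<in> carrier LLL"
      unfolding u_def
      using s by (rule linear_map_rules(1)[OF tensor_map_linear[OF pre_lie_map_linear id_linear]])
    have ct: "N.coproduct_twist l = u"
      unfolding N.coproduct_twist_def u_def s_def
      by (rule tensor_map_comp[OF coproduct_linear twist_linear pre_lie_map_linear id_linear AD, symmetric])
    have "N.twist_coproduct l =
        tensor_assoc K L L L (tensor_map K L LL (\<lambda>x. x) pre_lie_map (tensor_map K L LL \<alpha> \<Delta> (pre_lie_map (\<Delta> l))))"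
      unfolding N.twist_coproduct_def
        tensor_map_comp[OF twist_linear coproduct_linear id_linear pre_lie_map_linear AD] ..
    also have "\<dots> = right_iterate d"
      unfolding d_def by (rule right_iterate_eq[OF l])
    finally have tc: "N.twist_coproduct l = right_iterate d" .
    have eq: "u \<ominus>\<^bsub>LLL\<^esub> flip12 u = left_iterate d \<ominus>\<^bsub>LLL\<^esub> flip12 (left_iterate d)"
      using pre_lie_map_antisymmetrized12[OF s] unfolding u_def s_def d_def left_iterate_via_double_map[OF l] .
    note c = linear_map_rules(1)[OF left_iterate_linear d] linear_map_rules(1)[OF right_iterate_linear d]
      and F = linear_map_rules[OF flip12_linear]
    have "(u \<ominus>\<^bsub>LLL\<^esub> right_iterate d) \<ominus>\<^bsub>LLL\<^esub> flip12 (u \<ominus>\<^bsub>LLL\<^esub> right_iterate d) =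
        (u \<ominus>\<^bsub>LLL\<^esub> flip12 u) \<ominus>\<^bsub>LLL\<^esub> (right_iterate d \<ominus>\<^bsub>LLL\<^esub> flip12 (right_iterate d))"
      unfolding F(4)[OF u c(2)] by (rule LLL.M.minus_swap) (simp_all add: u c F)
    also have "\<dots> = (left_iterate d \<ominus>\<^bsub>LLL\<^esub> right_iterate d) \<ominus>\<^bsub>LLL\<^esub>
        flip12 (left_iterate d \<ominus>\<^bsub>LLL\<^esub> right_iterate d)"
      unfolding F(4)[OF c] eq by (rule LLL.M.minus_swap) (simp_all add: c F)
    also have "\<dots> = \<zero>\<^bsub>LLL\<^esub>"
      unfolding iterate_difference_symmetric[OF d] using c by simp
    finally show "(N.coproduct_twist l \<ominus>\<^bsub>LLL\<^esub> N.twist_coproduct l) \<ominus>\<^bsub>LLL\<^esub>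
        N.flip12 (N.coproduct_twist l \<ominus>\<^bsub>LLL\<^esub> N.twist_coproduct l) = \<zero>\<^bsub>LLL\<^esub>"
      unfolding ct tc .
  qed
qed

end

theorem theorem4p2:
  fixes K :: "('k, 'r) ring_scheme" and L :: "('k, 'l, 'm) module_scheme"
    and \<Delta> :: "'l \<Rightarrow> ('l \<times> 'l \<Rightarrow> 'k) set" and \<phi> \<alpha> R :: "'l \<Rightarrow> 'l"
  assumes "rota_baxter_hom_coass_coder_pair K L \<Delta> \<phi> \<alpha> R (\<ominus>\<^bsub>K\<^esub> \<one>\<^bsub>K\<^esub>)"
  shows "hom_pre_lie_coder_pair K L
    (\<lambda>l. tensor_map K L L R (\<lambda>x. x) (\<Delta> l)
        \<ominus>\<^bsub>tensor_space K L L\<^esub> tensor_flip K L L (tensor_map K L L (\<lambda>x. x) R (\<Delta> l))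
        \<ominus>\<^bsub>tensor_space K L L\<^esub> \<Delta> l)
    \<phi> \<alpha>"
proof -
  interpret rota_baxter_weight_minus_one K L \<Delta> \<phi> \<alpha> R
    using assms by (rule rota_baxter_weight_minus_one.intro)
  show ?thesis using pre_lie_coproduct_pair by (simp add: pre_lie_map_def)
qed

end
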